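(* Let $f_i(\boldsymbol x):=\frac12\boldsymbol x^T\boldsymbol A_i\boldsymbol x+\boldsymbol b_i^T\boldsymbol x$ with $f_i\in C_L^1(\mathbb R^d)$ for $i\in[n]$. Assume that $F(\boldsymbol x):=\frac1n\sum_{i=1}^n f_i(\boldsymbol x)=\frac12\boldsymbol x^T\boldsymbol A\boldsymbol x$ and that $F$ is $\mu$-strongly convex (so its minimizer is $\boldsymbol x^*=\boldsymbol 0$). Consider RandomShuffle with initialization $\boldsymbol x_0$, run for a number of epochs $K$ satisfying $K\ge\frac{32}{3}\kappa\max\{1,\sqrt{\kappa/n}\}\log(nK)$, with constant step size $\eta_i^k=\eta:=\frac{2\log(nK)}{\mu nK}$. Then the following bound holds for some $c_1=O(\kappa^4)$ and $c_2=O(\kappa^4)$: $$\mathbb E\big[F(\boldsymbol x_0^{K+1})\big]-F^*\;\le\;\frac{2L\|\boldsymbol x_0-\boldsymbol x^*\|^2}{n^2K^2}+\frac{c_1\cdot\log^2(nK)}{n^2K^2}+\frac{c_2\cdot\log^4(nK)}{nK^3}.$$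
   Context: Setting: $n\ge2$ and $d\ge1$ are integers, $[a]:=\{1,\dots,a\}$, $\boldsymbol A_i\in\mathbb R^{d\times d}$ are symmetric (not necessarily positive semidefinite), $\boldsymbol b_i\in\mathbb R^d$, $\boldsymbol A=\frac1n\sum_i\boldsymbol A_i$, $\|\cdot\|$ is the Euclidean norm, $\log$ is the natural logarithm, $L,\mu>0$, $\kappa:=L/\mu$, $F^*:=\min F$. The condition $f_i\in C_L^1(\mathbb R^d)$ ($L$-smoothness) means that the spectral norm of $\boldsymbol A_i$ is at most $L$; $\mu$-strong convexity of $F$ means $\boldsymbol A\succeq\mu\boldsymbol I$. Since $F=\frac12\boldsymbol x^T\boldsymbol A\boldsymbol x$, one has $\sum_i\boldsymbol b_i=\boldsymbol 0$. RandomShuffle: set $\boldsymbol x_0^1:=\boldsymbol x_0$. In each epoch $k=1,\dots,K$ draw a permutation $\sigma_k$ of $[n]$ uniformly at random, independently across epochs, and for $i=1,\dots,n$ set $\boldsymbol x_i^k:=\boldsymbol x_{i-1}^k-\eta_i^k\nabla f_{\sigma_k(i)}(\boldsymbol x_{i-1}^k)$; then set $\boldsymbol x_0^{k+1}:=\boldsymbol x_n^k$. The expectation is over the random permutations. Meaning of $c_j=O(\kappa^4)$: let $G:=\max_{i\in[n]}\|\boldsymbol b_i\|$. The paper uses the convention $\kappa=\Theta(1/\mu)$, so $L$ and $G$ are treated as constants: $c_j\le C\kappa^4$ where $C$ depends only on $L$ and $G$ (not on $\mu,n,K,d$). *)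

theory Defs
  imports
    "HOL-Probability.Product_PMF"
    "HOL-Combinatorics.Permutations"
    "Jordan_Normal_Form.Matrix"
begin

text \<open>
  Vectors and matrices carry their dimension as a natural number, so that \<open>d\<close> can be
  quantified inside a formula. \<open>HOL-Analysis\<close> and theory \<open>Matrix\<close> both declare \<open>vec\<close>, \<open>mat\<close>
  and an infix bullet; the versions of \<open>Matrix\<close> are meant throughout.
\<close>

definition euclid_norm :: "real Matrix.vec \<Rightarrow> real" where
  "euclid_norm v = sqrt (scalar_prod v v)"

definition symmetric_mat :: "real Matrix.mat \<Rightarrow> bool" where
  "symmetric_mat M \<longleftrightarrow> transpose_mat M = M"

definition spectral_norm :: "real Matrix.mat \<Rightarrow> real" where
  "spectral_norm M =
     (SUP v \<in> {v \<in> carrier_vec (dim_col M). euclid_norm v \<le> 1}. euclid_norm (M *\<^sub>v v))"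

definition pos_semidef :: "real Matrix.mat \<Rightarrow> bool" where
  "pos_semidef M \<longleftrightarrow>
     square_mat M \<and> symmetric_mat M \<and>
     (\<forall>v \<in> carrier_vec (dim_row M). scalar_prod v (M *\<^sub>v v) \<ge> 0)"

definition quadratic :: "real Matrix.mat \<Rightarrow> real Matrix.vec \<Rightarrow> real Matrix.vec \<Rightarrow> real" where
  "quadratic M b x = 1 / 2 * scalar_prod x (M *\<^sub>v x) + scalar_prod b x"

definition mean_fun :: "nat \<Rightarrow> (nat \<Rightarrow> real Matrix.vec \<Rightarrow> real) \<Rightarrow> real Matrix.vec \<Rightarrow> real" where
  "mean_fun n f x = (1 / real n) * (\<Sum>i = 1..n. f i x)"

text \<open>The entrywise average; the type of matrices has no zero, so \<open>sum\<close> does not apply to it.\<close>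

definition mean_mat :: "nat \<Rightarrow> nat \<Rightarrow> (nat \<Rightarrow> real Matrix.mat) \<Rightarrow> real Matrix.mat" where
  "mean_mat d n A = Matrix.mat d d (\<lambda>(r, c). (1 / real n) * (\<Sum>i = 1..n. A i $$ (r, c)))"

text \<open>The vector of partial derivatives.\<close>

definition gradient :: "(real Matrix.vec \<Rightarrow> real) \<Rightarrow> real Matrix.vec \<Rightarrow> real Matrix.vec" where
  "gradient f x =
     Matrix.vec (dim_vec x) (\<lambda>j. deriv (\<lambda>t. f (x + t \<cdot>\<^sub>v unit_vec (dim_vec x) j)) 0)"

text \<open>
  For components \<open>f\<close>, step sizes \<open>\<eta>\<close> (indexed by \<open>i\<close>) and a permutation \<open>\<sigma>\<close>, the iterate after
  \<open>i\<close> steps of an epoch that starts in \<open>x\<close>.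
\<close>

primrec epoch_iter ::
  "(nat \<Rightarrow> real Matrix.vec \<Rightarrow> real) \<Rightarrow> (nat \<Rightarrow> real) \<Rightarrow> (nat \<Rightarrow> nat) \<Rightarrow>
   real Matrix.vec \<Rightarrow> nat \<Rightarrow> real Matrix.vec" where
  "epoch_iter f \<eta> \<sigma> x 0 = x"
| "epoch_iter f \<eta> \<sigma> x (Suc i) =
     epoch_iter f \<eta> \<sigma> x i - \<eta> (Suc i) \<cdot>\<^sub>v gradient (f (\<sigma> (Suc i))) (epoch_iter f \<eta> \<sigma> x i)"

text \<open>
  \<open>random_shuffle n f \<eta> \<sigma> x\<^sub>0 k\<close> is the point reached after \<open>k\<close> complete epochs, that is, the
  starting point of epoch \<open>k + 1\<close>. Epochs are numbered from 1, and \<open>\<eta> k i\<close> is the size of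
  step \<open>i\<close> of epoch \<open>k\<close>.
\<close>

primrec random_shuffle ::
  "nat \<Rightarrow> (nat \<Rightarrow> real Matrix.vec \<Rightarrow> real) \<Rightarrow> (nat \<Rightarrow> nat \<Rightarrow> real) \<Rightarrow> (nat \<Rightarrow> nat \<Rightarrow> nat) \<Rightarrow>
   real Matrix.vec \<Rightarrow> nat \<Rightarrow> real Matrix.vec" where
  "random_shuffle n f \<eta> \<sigma> x\<^sub>0 0 = x\<^sub>0"
| "random_shuffle n f \<eta> \<sigma> x\<^sub>0 (Suc k) =
     epoch_iter f (\<eta> (Suc k)) (\<sigma> (Suc k)) (random_shuffle n f \<eta> \<sigma> x\<^sub>0 k) n"

text \<open>
  The joint law of \<open>\<sigma> 1, \<dots>, \<sigma> K\<close>: independent, each uniform on the permutations of \<open>{1..n}\<close>.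
  Outside \<open>{1..K}\<close> the value is fixed to \<open>id\<close>.
\<close>

definition shuffle_pmf :: "nat \<Rightarrow> nat \<Rightarrow> (nat \<Rightarrow> nat \<Rightarrow> nat) pmf" where
  "shuffle_pmf n K = Pi_pmf {1..K} id (\<lambda>_. pmf_of_set {\<pi>. \<pi> permutes {1..n}})"

end

theory Submission
  imports Defs
begin

text \<open>
  An epoch that starts in \<open>y\<close> ends in \<open>y - \<eta> n A y + r\<close>, because the \<open>b\<^sub>i\<close> sum to zero. Here \<open>r\<close> is
  \<open>- \<eta> (V\<^sub>1 \<delta>\<^sub>0 + \<dots> + V\<^sub>n \<delta>\<^sub>n\<^sub>-\<^sub>1)\<close>, where \<open>V\<^sub>i\<close> is the matrix used in step \<open>i\<close> and \<open>\<delta>\<^sub>i\<close> the drift of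
  the iterates. Partial sums of a randomly permuted family vary no more than those of an independent
  sample, so the root mean square of \<open>\<delta>\<^sub>i\<close> is of order
  \<open>\<eta> n \<parallel>A y\<parallel> + \<eta> \<surd>n (L \<parallel>y\<parallel> + G)\<close>, and that of \<open>r\<close> is smaller by the factor \<open>\<epsilon> = \<eta> n L\<close>.
  Only for \<open>\<langle>y, E r\<rangle>\<close> this bound is too weak. Its second order part can be computed, since a uniform
  permutation and its reversal have the same law. The third order part consists of the terms
  \<open>\<eta>\<^sup>2 \<langle>y, V\<^sub>i V\<^sub>j \<delta>\<^sub>j\<^sub>-\<^sub>1\<rangle>\<close> with \<open>j < i\<close>; moving \<open>V\<^sub>i\<close> and \<open>V\<^sub>j\<close> to the side of \<open>y\<close> makes the sum over
  \<open>i\<close> again a partial sum of a permuted family. With \<open>\<parallel>A y\<parallel>\<^sup>2 \<le> L \<langle>y, A y\<rangle>\<close> this gives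
  \<open>E \<parallel>x\<^sub>n\<parallel>\<^sup>2 \<le> (1 - \<eta> n \<mu>) \<parallel>y\<parallel>\<^sup>2 + O (\<eta>\<^sup>3 n G\<^sup>2 / \<mu> + \<eta>\<^sup>4 n\<^sup>3 G\<^sup>2)\<close>, which is iterated over the epochs.
\<close>

subsection \<open>Averages over a finite set\<close>

definition avg :: "'p set \<Rightarrow> ('p \<Rightarrow> real) \<Rightarrow> real" where
  "avg P f = (\<Sum>p\<in>P. f p) / real (card P)"

text \<open>The L2 norm for the uniform distribution on \<open>P\<close>. Sums of drifts are bounded
  by its triangle inequality, so their squares are never expanded.\<close>

definition rms :: "'p set \<Rightarrow> ('p \<Rightarrow> 'a::real_normed_vector) \<Rightarrow> real" where
  "rms P f = sqrt (avg P (\<lambda>p. (norm (f p))\<^sup>2))"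

lemma avg_cong: "(\<And>p. p \<in> P \<Longrightarrow> f p = g p) \<Longrightarrow> avg P f = avg P g"
  unfolding avg_def by (metis (no_types, lifting) sum.cong)

lemma avg_add: "avg P (\<lambda>p. f p + g p) = avg P f + avg P g"
  by (simp add: avg_def sum.distrib add_divide_distrib)

lemma avg_cmult: "avg P (\<lambda>p. c * f p) = c * avg P f"
  by (simp add: avg_def sum_distrib_left)

lemma avg_diff: "avg P (\<lambda>p. f p - g p) = avg P f - avg P g"
  by (simp add: avg_def sum_subtractf diff_divide_distrib)

lemma avg_sum: "avg P (\<lambda>p. \<Sum>i\<in>I. f i p) = (\<Sum>i\<in>I. avg P (f i))"
  unfolding avg_def sum_divide_distrib by (rule sum.swap)

lemma avg_mono: "(\<And>p. p \<in> P \<Longrightarrow> f p \<le> g p) \<Longrightarrow> avg P f \<le> avg P g"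
  unfolding avg_def by (intro divide_right_mono sum_mono) auto

lemma avg_const: "finite P \<Longrightarrow> P \<noteq> {} \<Longrightarrow> avg P (\<lambda>p. c) = c"
  by (simp add: avg_def)

lemma rms_eq_L2_set: "rms P f = L2_set (\<lambda>p. norm (f p)) P / sqrt (real (card P))"
  by (simp add: rms_def avg_def L2_set_def real_sqrt_divide)

lemma rms_nonneg: "0 \<le> rms P f"
  by (simp add: rms_eq_L2_set)

lemma rms_power2: "(rms P f)\<^sup>2 = avg P (\<lambda>p. (norm (f p))\<^sup>2)"
  by (simp add: rms_def avg_def sum_nonneg)

lemma rms_cong: "(\<And>p. p \<in> P \<Longrightarrow> f p = g p) \<Longrightarrow> rms P f = rms P g"
  unfolding rms_def by (metis (no_types, lifting) avg_cong)

lemma rms_le_cmult: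
  assumes "\<And>p. p \<in> P \<Longrightarrow> norm (f p) \<le> c * norm (g p)" and "c \<ge> 0"
  shows "rms P f \<le> c * rms P g"
proof -
  have "L2_set (\<lambda>p. norm (f p)) P \<le> L2_set (\<lambda>p. c * norm (g p)) P"
    using assms by (intro L2_set_mono) auto
  also have "\<dots> = c * L2_set (\<lambda>p. norm (g p)) P"
    using assms by (simp add: L2_set_right_distrib)
  finally have "L2_set (\<lambda>p. norm (f p)) P / sqrt (real (card P))
      \<le> c * L2_set (\<lambda>p. norm (g p)) P / sqrt (real (card P))"
    by (rule divide_right_mono) simp
  then show ?thesis
    by (simp add: rms_eq_L2_set)
qed

lemma rms_scaleR: "rms P (\<lambda>p. c *\<^sub>R f p) = \<bar>c\<bar> * rms P f"
  by (simp add: rms_eq_L2_set L2_set_right_distrib[symmetric])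

lemma rms_triangle: "rms P (\<lambda>p. f p + g p) \<le> rms P f + rms P g"
proof -
  have "L2_set (\<lambda>p. norm (f p + g p)) P \<le> L2_set (\<lambda>p. norm (f p) + norm (g p)) P"
    by (intro L2_set_mono) (auto intro: norm_triangle_ineq)
  also have "\<dots> \<le> L2_set (\<lambda>p. norm (f p)) P + L2_set (\<lambda>p. norm (g p)) P"
    by (rule L2_set_triangle_ineq)
  finally have "L2_set (\<lambda>p. norm (f p + g p)) P / sqrt (real (card P))
      \<le> (L2_set (\<lambda>p. norm (f p)) P + L2_set (\<lambda>p. norm (g p)) P) / sqrt (real (card P))"
    by (rule divide_right_mono) simp
  then show ?thesis
    by (simp add: rms_eq_L2_set add_divide_distrib)
qed

lemma rms_sum: "finite I \<Longrightarrow> rms P (\<lambda>p. \<Sum>i\<in>I. f i p) \<le> (\<Sum>i\<in>I. rms P (f i))"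
proof (induction I rule: finite_induct)
  case empty
  then show ?case by (simp add: rms_def avg_def)
next
  case (insert i I)
  have "rms P (\<lambda>p. \<Sum>i\<in>insert i I. f i p) = rms P (\<lambda>p. f i p + (\<Sum>i\<in>I. f i p))"
    using insert by simp
  also have "\<dots> \<le> rms P (f i) + rms P (\<lambda>p. \<Sum>i\<in>I. f i p)"
    by (rule rms_triangle)
  finally show ?case
    using insert by simp
qed

text \<open>Cauchy-Schwarz twice: pointwise in the inner product space, then for the sum over
  \<open>P\<close>.\<close>

lemma avg_inner_le:
  fixes f g :: "'p \<Rightarrow> 'a::real_inner"
  shows "\<bar>avg P (\<lambda>p. inner (f p) (g p))\<bar> \<le> rms P f * rms P g"
proof -
  have "\<bar>\<Sum>p\<in>P. inner (f p) (g p)\<bar> \<le> (\<Sum>p\<in>P. \<bar>inner (f p) (g p)\<bar>)"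
    by (rule sum_abs)
  also have "\<dots> \<le> (\<Sum>p\<in>P. \<bar>norm (f p)\<bar> * \<bar>norm (g p)\<bar>)"
    by (intro sum_mono) (simp add: Cauchy_Schwarz_ineq2)
  also have "\<dots> \<le> L2_set (\<lambda>p. norm (f p)) P * L2_set (\<lambda>p. norm (g p)) P"
    by (rule L2_set_mult_ineq)
  finally have "\<bar>\<Sum>p\<in>P. inner (f p) (g p)\<bar> / real (card P)
      \<le> L2_set (\<lambda>p. norm (f p)) P * L2_set (\<lambda>p. norm (g p)) P / real (card P)"
    by (rule divide_right_mono) simp
  then show ?thesis
    by (simp add: rms_eq_L2_set avg_def)
qed

subsection \<open>Averages over permutations\<close>

definition perms :: "nat \<Rightarrow> (nat \<Rightarrow> nat) set" where
  "perms n = {\<pi>. \<pi> permutes {1..n}}"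

lemma finite_perms: "finite (perms n)"
  unfolding perms_def by (rule finite_permutations) simp

lemma perms_nonempty: "perms n \<noteq> {}"
  unfolding perms_def using permutes_id by blast

lemma perms_in: "\<pi> \<in> perms n \<Longrightarrow> i \<in> {1..n} \<Longrightarrow> \<pi> i \<in> {1..n}"
  unfolding perms_def using permutes_in_image by fastforce

lemma sum_perm:
  fixes f :: "nat \<Rightarrow> 'a::comm_monoid_add"
  assumes "\<pi> \<in> perms n"
  shows "(\<Sum>j = 1..n. f (\<pi> j)) = (\<Sum>a = 1..n. f a)"
  using assms sum.permute[of \<pi> "{1..n}" f] by (simp add: o_def perms_def)

lemma avg_perms_const: "avg (perms n) (\<lambda>\<pi>. c) = c"
  by (simp add: avg_const finite_perms perms_nonempty)

text \<open>Right composition with \<open>q\<close> is a bijection of the permutations. A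
  transposition as \<open>q\<close> makes positions exchangeable; the reversal serves the sums over
  ordered pairs.\<close>

lemma avg_perms_compose:
  assumes "q permutes {1..n}"
  shows "avg (perms n) (\<lambda>\<pi>. f (\<pi> \<circ> q)) = avg (perms n) f"
  unfolding avg_def perms_def using sum_permutations_compose_right[OF assms, of f] by simp

text \<open>By exchangeability the average is the same at every position \<open>j\<close>, and the
  values at all positions add up to a sum that does not depend on \<open>\<pi>\<close>.\<close>

lemma avg_perms_single:
  assumes i: "i \<in> {1..n}"
  shows "avg (perms n) (\<lambda>\<pi>. f (\<pi> i)) = (\<Sum>a = 1..n. f a) / real n"
proof -
  have eq: "avg (perms n) (\<lambda>\<pi>. f (\<pi> j)) = avg (perms n) (\<lambda>\<pi>. f (\<pi> i))" if "j \<in> {1..n}" for j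
    using avg_perms_compose[OF permutes_swap_id[OF i that], of "\<lambda>\<pi>. f (\<pi> i)"] by simp
  have "real n * avg (perms n) (\<lambda>\<pi>. f (\<pi> i)) = (\<Sum>j = 1..n. avg (perms n) (\<lambda>\<pi>. f (\<pi> j)))"
    using eq by simp
  also have "\<dots> = avg (perms n) (\<lambda>\<pi>. \<Sum>j = 1..n. f (\<pi> j))"
    by (simp add: avg_sum)
  also have "\<dots> = avg (perms n) (\<lambda>\<pi>. \<Sum>a = 1..n. f a)"
    by (intro avg_cong sum_perm)
  also have "\<dots> = (\<Sum>a = 1..n. f a)"
    by (simp add: avg_perms_const)
  finally show ?thesis
    using i by (simp add: field_simps)
qed

text \<open>
  By symmetry \<open>j\<close> can be replaced by any position \<open>k \<noteq> i\<close>, and the values of \<open>g\<close> at these positions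
  add up to \<open>n m - g (\<pi> i)\<close>.
\<close>

lemma avg_perms_inner_pair:
  fixes g :: "nat \<Rightarrow> 'a::real_inner"
  assumes i: "i \<in> {1..n}" and j: "j \<in> {1..n}" and "i \<noteq> j"
    and mean: "(\<Sum>a = 1..n. g a) = real n *\<^sub>R m"
  shows "avg (perms n) (\<lambda>\<pi>. inner (g (\<pi> i)) (g (\<pi> j))) \<le> (norm m)\<^sup>2"
proof -
  let ?c = "avg (perms n) (\<lambda>\<pi>. inner (g (\<pi> i)) (g (\<pi> j)))"
  define q where "q = (\<Sum>a = 1..n. (norm (g a))\<^sup>2) / real n"
  have n: "n \<ge> 2" using i j \<open>i \<noteq> j\<close> by auto
  have "avg (perms n) (\<lambda>\<pi>. inner (g (\<pi> i)) (g (\<pi> k))) = ?c" if k: "k \<in> {1..n} - {i}" for k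
    using avg_perms_compose[OF permutes_swap_id[OF j, of k],
        of "\<lambda>\<pi>. inner (g (\<pi> i)) (g (\<pi> j))"] k \<open>i \<noteq> j\<close>
    by (simp add: transpose_def)
  then have "(\<Sum>k\<in>{1..n} - {i}. avg (perms n) (\<lambda>\<pi>. inner (g (\<pi> i)) (g (\<pi> k)))) = (real n - 1) * ?c"
    using i n by (simp add: of_nat_diff)
  moreover have "(\<Sum>k\<in>{1..n} - {i}. avg (perms n) (\<lambda>\<pi>. inner (g (\<pi> i)) (g (\<pi> k))))
      = avg (perms n) (\<lambda>\<pi>. inner (real n *\<^sub>R m) (g (\<pi> i)) - (norm (g (\<pi> i)))\<^sup>2)"
    unfolding avg_sum[symmetric]
  proof (rule avg_cong)
    fix \<pi> assume "\<pi> \<in> perms n"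
    then have "(\<Sum>k\<in>{1..n} - {i}. g (\<pi> k)) = real n *\<^sub>R m - g (\<pi> i)"
      using sum_perm[of \<pi> n g] mean i by (simp add: sum_diff1)
    then show "(\<Sum>k\<in>{1..n} - {i}. inner (g (\<pi> i)) (g (\<pi> k)))
        = inner (real n *\<^sub>R m) (g (\<pi> i)) - (norm (g (\<pi> i)))\<^sup>2"
      unfolding inner_sum_right[symmetric]
      by (simp only: inner_diff_right inner_commute[of "g (\<pi> i)" "real n *\<^sub>R m"] power2_norm_eq_inner)
  qed
  moreover have "\<dots> = real n * (norm m)\<^sup>2 - q"
  proof -
    have "avg (perms n) (\<lambda>\<pi>. inner (real n *\<^sub>R m) (g (\<pi> i))) = (\<Sum>a = 1..n. inner (real n *\<^sub>R m) (g a)) / real n"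
      by (rule avg_perms_single[OF i])
    also have "\<dots> = inner (real n *\<^sub>R m) (real n *\<^sub>R m) / real n"
      by (simp only: inner_sum_right[symmetric] mean)
    also have "\<dots> = real n * (norm m)\<^sup>2"
      using n by (simp add: power2_norm_eq_inner)
    finally show ?thesis
      by (simp add: avg_diff q_def avg_perms_single[OF i, of "\<lambda>a. (norm (g a))\<^sup>2"])
  qed
  ultimately have c: "(real n - 1) * ?c = real n * (norm m)\<^sup>2 - q" by simp
  \<comment> \<open>Nonnegativity of the variance of \<open>g\<close>. Together with fact
    \<open>c\<close> it says that the values at two distinct positions are never positively
    correlated.\<close>
  have "0 \<le> (\<Sum>a = 1..n. (norm (g a - m))\<^sup>2)"
    by (simp add: sum_nonneg)
  also have "\<dots> = (\<Sum>a = 1..n. (norm (g a))\<^sup>2) - 2 * inner (\<Sum>a = 1..n. g a) m + real n * (norm m)\<^sup>2"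
    by (simp add: power2_norm_eq_inner inner_diff_left inner_diff_right inner_commute
        sum.distrib sum_subtractf inner_sum_left inner_sum_right sum_distrib_left algebra_simps)
  also have "\<dots> = real n * (q - (norm m)\<^sup>2)"
    unfolding mean using n by (simp add: q_def power2_norm_eq_inner algebra_simps)
  finally have "(norm m)\<^sup>2 \<le> q"
    using n by (simp add: zero_le_mult_iff)
  then have "(real n - 1) * ?c \<le> (real n - 1) * (norm m)\<^sup>2"
    using c by (simp add: algebra_simps)
  then show ?thesis
    using n by (simp add: mult_le_cancel_left_pos)
qed

text \<open>The square expands into pairs of positions: distinct pairs contribute at most
  \<open>(norm m)\<^sup>2\<close> each, diagonal ones at most \<open>B\<^sup>2\<close>. So the
  fluctuation enters with the factor \<open>n\<close>, not \<open>n\<^sup>2\<close>. The set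
  \<open>I\<close> will be an initial segment for the drift and a final segment in
  \<open>avg_second_order_le\<close>.\<close>

lemma avg_perms_norm_sum:
  fixes g :: "nat \<Rightarrow> 'a::real_inner"
  assumes I: "I \<subseteq> {1..n}"
    and mean: "(\<Sum>a = 1..n. g a) = real n *\<^sub>R m"
    and bound: "\<And>a. a \<in> {1..n} \<Longrightarrow> norm (g a) \<le> B"
  shows "avg (perms n) (\<lambda>\<pi>. (norm (\<Sum>i\<in>I. g (\<pi> i)))\<^sup>2) \<le> (real n * norm m)\<^sup>2 + real n * B\<^sup>2"
proof -
  have fin: "finite I" using I finite_subset by blast
  have card: "card I \<le> n" using card_mono[OF _ I] by simp
  let ?e = "\<lambda>i j. avg (perms n) (\<lambda>\<pi>. inner (g (\<pi> i)) (g (\<pi> j)))"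
  have diag: "?e i i \<le> B\<^sup>2" if "i \<in> I" for i
  proof -
    have "?e i i \<le> avg (perms n) (\<lambda>\<pi>. B\<^sup>2)"
    proof (rule avg_mono)
      fix \<pi> assume "\<pi> \<in> perms n"
      then have "\<pi> i \<in> {1..n}" using that I perms_in by blast
      then show "inner (g (\<pi> i)) (g (\<pi> i)) \<le> B\<^sup>2"
        using bound[of "\<pi> i"] by (simp add: power2_norm_eq_inner[symmetric] power_mono)
    qed
    then show ?thesis
      by (simp add: avg_perms_const)
  qed
  have "?e i j \<le> (norm m)\<^sup>2 + (if i = j then B\<^sup>2 else 0)" if "i \<in> I" "j \<in> I" for i j
  proof (cases "i = j")
    case True
    then show ?thesis using diag[OF that(1)] by (simp add: add_increasing)
  next
    case False
    moreover have "i \<in> {1..n}" "j \<in> {1..n}" using that I by auto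
    ultimately show ?thesis using avg_perms_inner_pair[OF _ _ _ mean] by simp
  qed
  then have "(\<Sum>i\<in>I. \<Sum>j\<in>I. ?e i j) \<le> (\<Sum>i\<in>I. \<Sum>j\<in>I. (norm m)\<^sup>2 + (if i = j then B\<^sup>2 else 0))"
    by (intro sum_mono)
  also have "\<dots> = (real (card I))\<^sup>2 * (norm m)\<^sup>2 + real (card I) * B\<^sup>2"
    using fin by (simp add: sum.distrib power2_eq_square algebra_simps)
  also have "\<dots> \<le> (real n)\<^sup>2 * (norm m)\<^sup>2 + real n * B\<^sup>2"
    using card by (intro add_mono mult_right_mono power_mono) auto
  finally have "avg (perms n) (\<lambda>\<pi>. \<Sum>i\<in>I. \<Sum>j\<in>I. inner (g (\<pi> i)) (g (\<pi> j)))
      \<le> (real n)\<^sup>2 * (norm m)\<^sup>2 + real n * B\<^sup>2"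
    by (simp only: avg_sum)
  moreover have "(norm (\<Sum>i\<in>I. g (\<pi> i)))\<^sup>2 = (\<Sum>i\<in>I. \<Sum>j\<in>I. inner (g (\<pi> i)) (g (\<pi> j)))" for \<pi>
    by (simp only: power2_norm_eq_inner inner_sum_left) (simp only: inner_sum_right)
  ultimately show ?thesis
    by (simp add: power_mult_distrib)
qed

lemma sum_swap_triangle:
  fixes f :: "nat \<Rightarrow> nat \<Rightarrow> 'b::comm_monoid_add"
  shows "(\<Sum>i = 1..m. \<Sum>j = 1..i - 1. f i j) = (\<Sum>j = 1..m. \<Sum>i = j + 1..m. f i j)"
proof -
  have "(\<Sum>i = 1..m. \<Sum>j = 1..i - 1. f i j) = (\<Sum>i = 1..m. \<Sum>j\<in>{j\<in>{1..m}. j < i}. f i j)"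
    by (intro sum.cong) auto
  also have "\<dots> = (\<Sum>j = 1..m. \<Sum>i\<in>{i\<in>{1..m}. j < i}. f i j)"
    by (rule sum.swap_restrict) auto
  also have "\<dots> = (\<Sum>j = 1..m. \<Sum>i = j + 1..m. f i j)"
    by (intro sum.cong) auto
  finally show ?thesis .
qed

text \<open>Reversing a permutation exchanges the pairs of positions below and above the diagonal.\<close>

lemma avg_perms_triangle:
  fixes f :: "nat \<Rightarrow> nat \<Rightarrow> real"
  shows "2 * avg (perms n) (\<lambda>\<pi>. \<Sum>i = 1..n. \<Sum>j = 1..i - 1. f (\<pi> i) (\<pi> j))
    = (\<Sum>a = 1..n. \<Sum>c = 1..n. f a c) - (\<Sum>a = 1..n. f a a)"
proof -
  let ?low = "\<lambda>\<pi>. \<Sum>i = 1..n. \<Sum>j = 1..i - 1. f (\<pi> i) (\<pi> j)"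
  let ?up = "\<lambda>\<pi>. \<Sum>i = 1..n. \<Sum>j = i + 1..n. f (\<pi> i) (\<pi> j)"
  \<comment> \<open>The reversal of positions. It is an involution and hence its own inverse
    witness.\<close>
  define \<rho> where "\<rho> i = (if i \<in> {1..n} then n + 1 - i else i)" for i
  have \<rho>: "\<rho> permutes {1..n}"
    by (rule bij_imp_permutes, rule bij_betw_byWitness[where f' = \<rho>]) (auto simp: \<rho>_def)
  have low_rev: "?low (\<pi> \<circ> \<rho>) = ?up \<pi>" for \<pi>
  proof -
    have inner: "(\<Sum>j = 1..i - 1. f (\<pi> (\<rho> i)) (\<pi> (\<rho> j))) = (\<Sum>j = \<rho> i + 1..n. f (\<pi> (\<rho> i)) (\<pi> j))"
      if "i \<in> {1..n}" for i
      using that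
      by (intro sum.reindex_bij_witness[where i = "\<lambda>j. n + 1 - j" and j = "\<lambda>j. n + 1 - j"])
         (auto simp: \<rho>_def)
    have "?low (\<pi> \<circ> \<rho>) = (\<Sum>i = 1..n. \<Sum>j = \<rho> i + 1..n. f (\<pi> (\<rho> i)) (\<pi> j))"
      unfolding comp_apply by (rule sum.cong[OF refl inner])
    also have "\<dots> = ?up \<pi>"
      using sum.permute[OF \<rho>, of "\<lambda>i. \<Sum>j = i + 1..n. f (\<pi> i) (\<pi> j)"] by (simp add: o_def)
    finally show ?thesis .
  qed
  have up: "avg (perms n) ?up = avg (perms n) ?low"
    using avg_perms_compose[OF \<rho>, of ?low] unfolding low_rev .
  have "2 * avg (perms n) ?low = avg (perms n) (\<lambda>\<pi>. ?low \<pi> + ?up \<pi>)"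
    unfolding avg_add up by simp
  also have "\<dots> = avg (perms n) (\<lambda>\<pi>. (\<Sum>a = 1..n. \<Sum>c = 1..n. f a c) - (\<Sum>a = 1..n. f a a))"
  proof (rule avg_cong)
    fix \<pi> assume \<pi>: "\<pi> \<in> perms n"
    have "?low \<pi> + ?up \<pi> = (\<Sum>i = 1..n. (\<Sum>j = 1..n. f (\<pi> i) (\<pi> j)) - f (\<pi> i) (\<pi> i))"
      unfolding sum.distrib[symmetric]
    proof (rule sum.cong[OF refl])
      fix i assume i: "i \<in> {1..n}"
      then have "{1..n} = insert i ({1..i - 1} \<union> {i + 1..n})" by auto
      then have "(\<Sum>j = 1..n. f (\<pi> i) (\<pi> j)) = (\<Sum>j\<in>insert i ({1..i - 1} \<union> {i + 1..n}). f (\<pi> i) (\<pi> j))"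
        by simp
      also have "\<dots> = f (\<pi> i) (\<pi> i) + ((\<Sum>j = 1..i - 1. f (\<pi> i) (\<pi> j)) + (\<Sum>j = i + 1..n. f (\<pi> i) (\<pi> j)))"
        using i by (subst sum.insert) (auto simp: sum.union_disjoint)
      finally show "(\<Sum>j = 1..i - 1. f (\<pi> i) (\<pi> j)) + (\<Sum>j = i + 1..n. f (\<pi> i) (\<pi> j))
          = (\<Sum>j = 1..n. f (\<pi> i) (\<pi> j)) - f (\<pi> i) (\<pi> i)" by simp
    qed
    also have "\<dots> = (\<Sum>i = 1..n. \<Sum>c = 1..n. f (\<pi> i) c) - (\<Sum>a = 1..n. f a a)"
      unfolding sum_subtractf sum_perm[OF \<pi>, of "\<lambda>a. f a a"] sum_perm[OF \<pi>, of "f _"] ..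
    also have "\<dots> = (\<Sum>a = 1..n. \<Sum>c = 1..n. f a c) - (\<Sum>a = 1..n. f a a)"
      unfolding sum_perm[OF \<pi>, of "\<lambda>a. \<Sum>c = 1..n. f a c"] ..
    finally show "?low \<pi> + ?up \<pi> = (\<Sum>a = 1..n. \<Sum>c = 1..n. f a c) - (\<Sum>a = 1..n. f a a)" .
  qed
  also have "\<dots> = (\<Sum>a = 1..n. \<Sum>c = 1..n. f a c) - (\<Sum>a = 1..n. f a a)"
    by (rule avg_perms_const)
  finally show ?thesis .
qed

subsection \<open>One epoch\<close>

text \<open>The operators act on an abstract inner product space. Positivity concerns only their
  mean and appears as a premise of the later lemmas that use it. \<open>small\<close> makes
  \<open>1 - \<epsilon>\<close> positive, the denominator of the drift bounds.\<close>

locale shuffled_quadratics =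
  fixes n :: nat and V :: "nat \<Rightarrow> 'a::real_inner \<Rightarrow> 'a" and b :: "nat \<Rightarrow> 'a" and L G \<eta> :: real
  assumes n_pos: "n > 0"
    and linear_V: "a \<in> {1..n} \<Longrightarrow> linear (V a)"
    and selfadjoint_V: "a \<in> {1..n} \<Longrightarrow> inner (V a x) y = inner x (V a y)"
    and norm_V_le: "a \<in> {1..n} \<Longrightarrow> norm (V a x) \<le> L * norm x"
    and norm_b_le: "a \<in> {1..n} \<Longrightarrow> norm (b a) \<le> G"
    and sum_b: "(\<Sum>a = 1..n. b a) = 0"
    and L_nonneg: "L \<ge> 0" and \<eta>_nonneg: "\<eta> \<ge> 0"
    and small: "\<eta> * real n * L < 1"
begin

lemma G_nonneg: "G \<ge> 0"
  using norm_b_le[of 1] n_pos norm_ge_zero[of "b 1"] by (simp del: norm_ge_zero)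

definition mean_op :: "'a \<Rightarrow> 'a" where
  "mean_op x = (1 / real n) *\<^sub>R (\<Sum>a = 1..n. V a x)"

primrec iter :: "(nat \<Rightarrow> nat) \<Rightarrow> 'a \<Rightarrow> nat \<Rightarrow> 'a" where
  "iter \<pi> y 0 = y"
| "iter \<pi> y (Suc i) = iter \<pi> y i - \<eta> *\<^sub>R (V (\<pi> (Suc i)) (iter \<pi> y i) + b (\<pi> (Suc i)))"

definition disp :: "(nat \<Rightarrow> nat) \<Rightarrow> 'a \<Rightarrow> nat \<Rightarrow> 'a" where
  "disp \<pi> y i = iter \<pi> y i - y"

text \<open>The error of replacing the epoch by one full gradient step.\<close>

definition residual :: "(nat \<Rightarrow> nat) \<Rightarrow> 'a \<Rightarrow> 'a" where
  "residual \<pi> y = - \<eta> *\<^sub>R (\<Sum>i = 1..n. V (\<pi> i) (disp \<pi> y (i - 1)))"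

abbreviation \<epsilon> :: real where "\<epsilon> \<equiv> \<eta> * real n * L"

text \<open>The bound of \<open>avg_perms_norm_sum\<close>, scaled by \<open>\<eta>\<close>, for
  mean \<open>mean_op y\<close> and terms of norm at most \<open>L * norm y + g\<close>. It is used
  with \<open>g = G\<close> for the gradients at \<open>y\<close> and with \<open>g = 0\<close> for
  the vectors \<open>V a y\<close>.\<close>

definition spread :: "real \<Rightarrow> 'a \<Rightarrow> real" where
  "spread g y = \<eta> * sqrt ((real n * norm (mean_op y))\<^sup>2 + real n * (L * norm y + g)\<^sup>2)"

lemma spread_nonneg: "0 \<le> spread g y"
  by (simp add: spread_def \<eta>_nonneg)

lemma sum_V: "(\<Sum>a = 1..n. V a x) = real n *\<^sub>R mean_op x"
  using n_pos by (simp add: mean_op_def)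

lemma sum_grad: "(\<Sum>a = 1..n. V a x + b a) = real n *\<^sub>R mean_op x"
  unfolding sum.distrib sum_V sum_b by simp

lemma norm_grad_le: "a \<in> {1..n} \<Longrightarrow> norm (V a x + b a) \<le> L * norm x + G"
  by (meson add_mono norm_V_le norm_b_le norm_triangle_le)

lemma disp_Suc:
  assumes "\<pi> \<in> perms n" "Suc i \<le> n"
  shows "disp \<pi> y (Suc i) = disp \<pi> y i
    - \<eta> *\<^sub>R (V (\<pi> (Suc i)) y + b (\<pi> (Suc i)) + V (\<pi> (Suc i)) (disp \<pi> y i))"
proof -
  have "\<pi> (Suc i) \<in> {1..n}" using assms perms_in by simp
  then have "V (\<pi> (Suc i)) (disp \<pi> y i) = V (\<pi> (Suc i)) (iter \<pi> y i) - V (\<pi> (Suc i)) y"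
    unfolding disp_def using linear_V linear_diff by blast
  then show ?thesis
    by (simp add: disp_def)
qed

text \<open>Linearity splits each gradient at an iterate into the gradient at \<open>y\<close> and
  the operator applied to the drift. The first sum is a partial sum of a permuted family; the second
  feeds the drift back with a factor \<open>\<eta>\<close>.\<close>

lemma disp_eq:
  assumes "\<pi> \<in> perms n"
  shows "i \<le> n \<Longrightarrow> disp \<pi> y i = - \<eta> *\<^sub>R
    ((\<Sum>j = 1..i. V (\<pi> j) y + b (\<pi> j)) + (\<Sum>j = 1..i. V (\<pi> j) (disp \<pi> y (j - 1))))"
proof (induction i)
  case 0
  then show ?case by (simp add: disp_def)
next
  case (Suc i)
  have "disp \<pi> y (Suc i) = disp \<pi> y i
    - \<eta> *\<^sub>R (V (\<pi> (Suc i)) y + b (\<pi> (Suc i)) + V (\<pi> (Suc i)) (disp \<pi> y i))"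
    using Suc assms by (intro disp_Suc) auto
  also have "\<dots> = - \<eta> *\<^sub>R ((\<Sum>j = 1..i. V (\<pi> j) y + b (\<pi> j)) + (\<Sum>j = 1..i. V (\<pi> j) (disp \<pi> y (j - 1))))
    - \<eta> *\<^sub>R (V (\<pi> (Suc i)) y + b (\<pi> (Suc i)) + V (\<pi> (Suc i)) (disp \<pi> y i))"
    using Suc by simp
  finally show ?case
    by (simp add: scaleR_add_right)
qed

text \<open>Over a complete epoch the gradients at the fixed point \<open>y\<close> add up to the
  full gradient in any order, so all dependence on \<open>\<pi>\<close> sits in the
  residual.\<close>

lemma iter_eq:
  assumes "\<pi> \<in> perms n"
  shows "iter \<pi> y n = y - (\<eta> * real n) *\<^sub>R mean_op y + residual \<pi> y"
proof -
  have "(\<Sum>j = 1..n. V (\<pi> j) y + b (\<pi> j)) = real n *\<^sub>R mean_op y"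
    using sum_perm[OF assms, of "\<lambda>a. V a y + b a"] sum_grad by simp
  then have "disp \<pi> y n = - \<eta> *\<^sub>R (real n *\<^sub>R mean_op y) + residual \<pi> y"
    using disp_eq[OF assms, of n y] by (simp only: order.refl scaleR_add_right residual_def)
  then show ?thesis
    by (simp add: disp_def algebra_simps)
qed

lemma rms_partial_sum_le:
  assumes I: "I \<subseteq> {1..n}"
    and g: "(\<Sum>a = 1..n. g a) = real n *\<^sub>R mean_op y"
    and B: "\<And>a. a \<in> {1..n} \<Longrightarrow> norm (g a) \<le> L * norm y + c"
  shows "\<eta> * rms (perms n) (\<lambda>\<pi>. \<Sum>i\<in>I. g (\<pi> i)) \<le> spread c y"
  unfolding spread_def rms_def
  using avg_perms_norm_sum[OF I g B] \<eta>_nonneg by (intro mult_left_mono) auto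

lemma rms_V_le:
  assumes "i \<in> {1..n}"
  shows "rms (perms n) (\<lambda>\<pi>. V (\<pi> i) (f \<pi>)) \<le> L * rms (perms n) f"
  using assms perms_in norm_V_le L_nonneg by (intro rms_le_cmult) blast+

text \<open>The number \<open>D = spread G y / (1 - \<epsilon>)\<close> solves
  \<open>D = spread G y + \<epsilon> * D\<close>. Feeding back at most \<open>n\<close> earlier
  drifts, each of root mean square at most \<open>D\<close>, costs at most
  \<open>\<epsilon> * D\<close>, so strong induction keeps a bound uniform in
  \<open>i\<close>.\<close>

lemma rms_disp_le:
  "i \<le> n \<Longrightarrow> rms (perms n) (\<lambda>\<pi>. disp \<pi> y i) \<le> spread G y / (1 - \<epsilon>)"
proof (induction i rule: less_induct)
  case (less i)
  let ?D = "spread G y / (1 - \<epsilon>)"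
  let ?s = "\<lambda>\<pi>. \<Sum>j = 1..i. V (\<pi> j) y + b (\<pi> j)"
  let ?t = "\<lambda>\<pi>. \<Sum>j = 1..i. V (\<pi> j) (disp \<pi> y (j - 1))"
  have D: "?D \<ge> 0" using spread_nonneg small by simp
  have "rms (perms n) (\<lambda>\<pi>. disp \<pi> y i) = rms (perms n) (\<lambda>\<pi>. - \<eta> *\<^sub>R (?s \<pi> + ?t \<pi>))"
    using less.prems by (intro rms_cong disp_eq)
  also have "\<dots> = \<eta> * rms (perms n) (\<lambda>\<pi>. ?s \<pi> + ?t \<pi>)"
    using rms_scaleR[of "perms n" "- \<eta>"] \<eta>_nonneg by simp
  also have "\<dots> \<le> \<eta> * (rms (perms n) ?s + rms (perms n) ?t)"
    using \<eta>_nonneg rms_triangle by (intro mult_left_mono) auto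
  also have "\<dots> = \<eta> * rms (perms n) ?s + \<eta> * rms (perms n) ?t"
    by (rule distrib_left)
  also have "\<eta> * rms (perms n) ?s \<le> spread G y"
    using less.prems by (intro rms_partial_sum_le sum_grad norm_grad_le) auto
  also have "rms (perms n) ?t \<le> (\<Sum>j = 1..i. rms (perms n) (\<lambda>\<pi>. V (\<pi> j) (disp \<pi> y (j - 1))))"
    by (rule rms_sum) simp
  also have "\<dots> \<le> (\<Sum>j = 1..i. L * ?D)"
  proof (rule sum_mono)
    fix j assume j: "j \<in> {1..i}"
    have "rms (perms n) (\<lambda>\<pi>. V (\<pi> j) (disp \<pi> y (j - 1))) \<le> L * rms (perms n) (\<lambda>\<pi>. disp \<pi> y (j - 1))"
      using j less.prems by (intro rms_V_le) auto
    also have "\<dots> \<le> L * ?D"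
      using j less.prems L_nonneg by (intro mult_left_mono less.IH) auto
    finally show "rms (perms n) (\<lambda>\<pi>. V (\<pi> j) (disp \<pi> y (j - 1))) \<le> L * ?D" .
  qed
  also have "\<dots> = real i * (L * ?D)"
    by simp
  also have "\<dots> \<le> real n * (L * ?D)"
    using less.prems D L_nonneg by (intro mult_right_mono mult_nonneg_nonneg) auto
  finally have "rms (perms n) (\<lambda>\<pi>. disp \<pi> y i) \<le> spread G y + \<eta> * (real n * (L * ?D))"
    using \<eta>_nonneg by (simp add: mult_left_mono)
  also have "\<dots> = ?D"
    using small by (simp add: field_simps)
  finally show ?case .
qed

text \<open>The drift bound applied to each of the \<open>n\<close> terms. It serves where the
  residual is squared or paired with \<open>mean_op y\<close>; the pairing with \<open>y\<close>
  needs a finer analysis.\<close>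

lemma rms_residual_le: "rms (perms n) (\<lambda>\<pi>. residual \<pi> y) \<le> \<epsilon> / (1 - \<epsilon>) * spread G y"
proof -
  let ?D = "spread G y / (1 - \<epsilon>)"
  have "rms (perms n) (\<lambda>\<pi>. residual \<pi> y)
      = \<eta> * rms (perms n) (\<lambda>\<pi>. \<Sum>j = 1..n. V (\<pi> j) (disp \<pi> y (j - 1)))"
    unfolding residual_def using rms_scaleR[of "perms n" "- \<eta>"] \<eta>_nonneg by simp
  also have "\<dots> \<le> \<eta> * (\<Sum>j = 1..n. rms (perms n) (\<lambda>\<pi>. V (\<pi> j) (disp \<pi> y (j - 1))))"
    using \<eta>_nonneg by (intro mult_left_mono rms_sum) auto
  also have "\<dots> \<le> \<eta> * (\<Sum>j = 1..n. L * ?D)"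
  proof (intro mult_left_mono sum_mono \<eta>_nonneg)
    fix j assume j: "j \<in> {1..n}"
    have "rms (perms n) (\<lambda>\<pi>. V (\<pi> j) (disp \<pi> y (j - 1))) \<le> L * rms (perms n) (\<lambda>\<pi>. disp \<pi> y (j - 1))"
      using j by (rule rms_V_le)
    also have "\<dots> \<le> L * ?D"
      using j L_nonneg by (intro mult_left_mono rms_disp_le) auto
    finally show "rms (perms n) (\<lambda>\<pi>. V (\<pi> j) (disp \<pi> y (j - 1))) \<le> L * ?D" .
  qed
  finally show ?thesis by (simp add: mult.assoc)
qed

lemma selfadjoint_mean: "inner (mean_op x) y = inner x (mean_op y)"
  using selfadjoint_V by (simp add: mean_op_def inner_sum_left inner_sum_right)

end

section \<open>Scalar inequalities for the contraction of one epoch\<close>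

lemma norm_diff_add_power2:
  fixes x w r :: "'a::real_inner"
  shows "(norm (x - c *\<^sub>R w + r))\<^sup>2 = (norm x)\<^sup>2 - 2 * c * inner x w + c\<^sup>2 * (norm w)\<^sup>2
      + 2 * inner x r - 2 * c * inner w r + (norm r)\<^sup>2"
proof -
  have "(norm (x - c *\<^sub>R w + r))\<^sup>2 = (norm (x - c *\<^sub>R w))\<^sup>2 + 2 * inner (x - c *\<^sub>R w) r + (norm r)\<^sup>2"
    using dot_norm[of "x - c *\<^sub>R w" r] by (simp add: field_simps)
  moreover have "(norm (x - c *\<^sub>R w))\<^sup>2 = (norm x)\<^sup>2 - 2 * c * inner x w + c\<^sup>2 * (norm w)\<^sup>2"
    using dot_norm_neg[of x "c *\<^sub>R w"] by (simp add: power_mult_distrib)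
  moreover have "inner (x - c *\<^sub>R w) r = inner x r - c * inner w r"
    by (simp add: inner_diff_left)
  ultimately show ?thesis by (simp add: algebra_simps)
qed
text \<open>\<open>X\<close> is the gain of a full gradient step, \<open>\<theta> p\<^sup>2\<close> the part of it that is claimed.\<close>

lemma epoch_numerics:
  fixes p a s h e X \<theta> u \<tau>\<^sub>0 \<tau> :: real
  assumes nonneg: "a \<ge> 0" "s \<ge> 0" "h \<ge> 0" "e \<ge> 0" "\<tau>\<^sub>0 \<ge> 0" "\<tau> \<ge> 0" and "\<theta> > 0"
    and e: "e \<le> 3 / 13" and X: "\<theta> * p\<^sup>2 \<le> X" and a2: "a\<^sup>2 \<le> 3 / 16 * X"
    and s2: "e * s\<^sup>2 \<le> 9 / 208 * (\<theta> * p\<^sup>2)" and sh: "s * h = u * p"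
    and \<tau>\<^sub>0: "\<tau>\<^sub>0\<^sup>2 = a\<^sup>2 + s\<^sup>2" and \<tau>: "\<tau>\<^sup>2 = a\<^sup>2 + (s + h)\<^sup>2"
  shows "p\<^sup>2 - 2 * X + 2 * a\<^sup>2 + s * h + 2 * e * \<tau>\<^sub>0 * \<tau> + 2 * a * (e * \<tau>) + (e * \<tau>)\<^sup>2
    \<le> (1 - \<theta>) * p\<^sup>2 + 11 * u\<^sup>2 / \<theta> + 34 * e\<^sup>2 * h\<^sup>2"
proof -
  have \<tau>\<^sub>0_le: "\<tau>\<^sub>0 \<le> a + s"
    by (rule power2_le_imp_le) (use nonneg \<tau>\<^sub>0 in \<open>auto simp: power2_sum\<close>)
  have \<tau>_le: "\<tau> \<le> a + s + h"
    by (rule power2_le_imp_le) (use nonneg \<tau> in \<open>auto simp: power2_sum algebra_simps\<close>)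
  have 1: "2 * e * \<tau>\<^sub>0 * \<tau> \<le> 2 * e * ((a + s) * (a + s + h))"
    unfolding mult.assoc using \<tau>\<^sub>0_le \<tau>_le nonneg by (intro mult_left_mono mult_mono) auto
  have 2: "2 * a * (e * \<tau>) \<le> 2 * a * (e * (a + s + h))"
    using \<tau>_le nonneg by (intro mult_left_mono) auto
  have 3: "(e * \<tau>)\<^sup>2 \<le> e\<^sup>2 * (a\<^sup>2 + 2 * s\<^sup>2 + 2 * h\<^sup>2)"
  proof -
    have "0 \<le> (s - h)\<^sup>2" by simp
    then have "\<tau>\<^sup>2 \<le> a\<^sup>2 + 2 * s\<^sup>2 + 2 * h\<^sup>2" by (simp add: \<tau> power2_sum power2_diff)
    then show ?thesis by (simp add: power_mult_distrib mult_left_mono)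
  qed
  \<comment> \<open>The mixed products in \<open>1\<close> and \<open>2\<close> add up to
    \<open>6 * e * (a * s)\<close> and \<open>4 * e * (a * h)\<close>, apart from
    \<open>2 * e * (s * h)\<close>. They are split here and in \<open>5\<close>.\<close>
  have 4: "6 * e * (a * s) \<le> 3 * e * (a\<^sup>2 + s\<^sup>2)"
  proof -
    have "0 \<le> 3 * e * (a - s)\<^sup>2" using nonneg by simp
    then show ?thesis by (simp add: power2_diff algebra_simps)
  qed
  \<comment> \<open>The weight 16 leaves only \<open>a\<^sup>2 / 8\<close>; its price 32 and the 2
    from fact \<open>3\<close> give the coefficient 34.\<close>
  have 5: "4 * e * (a * h) \<le> a\<^sup>2 / 8 + 32 * e\<^sup>2 * h\<^sup>2"
  proof -
    have "0 \<le> (a - 16 * e * h)\<^sup>2 / 8" by simp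
    then show ?thesis by (simp add: power2_diff power_mult_distrib power_divide algebra_simps)
  qed
  \<comment> \<open>The weight \<open>190 / 13\<close> is ten times \<open>19 / 13\<close>, which
    leaves one twentieth of \<open>\<theta> * p\<^sup>2\<close>.\<close>
  have 6: "19 / 13 * (s * h) \<le> \<theta> * p\<^sup>2 / 20 + 11 * u\<^sup>2 / \<theta>"
  proof -
    have "0 \<le> (\<theta> * p - 190 / 13 * u)\<^sup>2 / (20 * \<theta>)" using \<open>\<theta> > 0\<close> by simp
    also have "\<dots> = \<theta> * p\<^sup>2 / 20 - 19 / 13 * (u * p) + 1805 / 169 * u\<^sup>2 / \<theta>"
      using \<open>\<theta> > 0\<close> by (simp add: power2_eq_square field_simps)
    also have "1805 / 169 * u\<^sup>2 / \<theta> \<le> 11 * u\<^sup>2 / \<theta>"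
      using \<open>\<theta> > 0\<close> by (intro divide_right_mono mult_right_mono) auto
    finally show ?thesis by (simp add: sh)
  qed
  have e2: "e\<^sup>2 \<le> 3 / 13 * e"
    using mult_right_mono[OF e nonneg(4)] by (simp add: power2_eq_square)
  \<comment> \<open>At \<open>e = 3 / 13\<close> the coefficient on the left is at most about
    3.7937.\<close>
  have 7: "(2 + 7 * e + e\<^sup>2 + 1 / 8) * a\<^sup>2 \<le> 3794 / 1000 * a\<^sup>2"
    using e e2 by (intro mult_right_mono) auto
  have 8: "5 * (e * s\<^sup>2) + 2 * (e\<^sup>2 * s\<^sup>2) \<le> 71 / 13 * (e * s\<^sup>2)"
    using mult_right_mono[OF e2, of "s\<^sup>2"] by simp
  have 9: "(1 + 2 * e) * (s * h) \<le> 19 / 13 * (s * h)"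
    using e nonneg by (intro mult_right_mono) auto
  have "2 * a\<^sup>2 + s * h + 2 * e * \<tau>\<^sub>0 * \<tau> + 2 * a * (e * \<tau>) + (e * \<tau>)\<^sup>2
      \<le> (2 + 7 * e + e\<^sup>2 + 1 / 8) * a\<^sup>2 + (5 * (e * s\<^sup>2) + 2 * (e\<^sup>2 * s\<^sup>2))
        + (1 + 2 * e) * (s * h) + 34 * e\<^sup>2 * h\<^sup>2"
    using 1 2 3 4 5 by (simp add: algebra_simps power2_eq_square)
  also have "\<dots> \<le> 3794 / 1000 * a\<^sup>2 + 71 / 13 * (e * s\<^sup>2) + (\<theta> * p\<^sup>2 / 20 + 11 * u\<^sup>2 / \<theta>) + 34 * e\<^sup>2 * h\<^sup>2"
    using 6 7 8 9 by linarith
  also have "\<dots> \<le> 2 * X - \<theta> * p\<^sup>2 + 11 * u\<^sup>2 / \<theta> + 34 * e\<^sup>2 * h\<^sup>2"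
  proof -
    have "0 \<le> \<theta> * p\<^sup>2" using \<open>\<theta> > 0\<close> by simp
    \<comment> \<open>The budget: \<open>3.794 * 3 / 16\<close> is about 0.7114 and
      \<open>71 / 13 * 9 / 208\<close> about 0.2363. With \<open>1 / 20\<close> they stay below 1,
      while \<open>2 * X - \<theta> * p\<^sup>2\<close> is at least \<open>X\<close>.\<close>
    then have "3794 / 1000 * a\<^sup>2 + 71 / 13 * (e * s\<^sup>2) + \<theta> * p\<^sup>2 / 20 \<le> 2 * X - \<theta> * p\<^sup>2"
      using a2 s2 X by linarith
    then show ?thesis by linarith
  qed
  finally show ?thesis by (simp add: algebra_simps)
qed

section \<open>Mean squared norm after one epoch\<close>

context shuffled_quadratics
begin

lemma linear_mean: "linear mean_op"
  unfolding mean_op_def using linear_V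
  by (intro linear_compose_scale_right linear_compose_sum) auto

lemma norm_mean_le: "norm (mean_op x) \<le> L * norm x"
proof -
  have "norm (\<Sum>a = 1..n. V a x) \<le> (\<Sum>a = 1..n. L * norm x)"
    by (rule sum_norm_le) (rule norm_V_le)
  then show ?thesis
    using n_pos by (simp add: mean_op_def field_simps)
qed

text \<open>For a positive self-adjoint \<open>M\<close> of norm at most \<open>L\<close> this is
  \<open>M\<^sup>2 \<le> L M\<close>. The form of \<open>M\<close> is evaluated at the test vector
  \<open>L *\<^sub>R y - mean_op y\<close>, which avoids a spectral decomposition and leaves a
  factor \<open>L\<close> to cancel.\<close>

lemma norm_mean_power2_le:
  assumes psd: "\<And>x. inner x (mean_op x) \<ge> 0"
  shows "(norm (mean_op y))\<^sup>2 \<le> L * inner y (mean_op y)"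
proof (cases "L = 0")
  case True
  then show ?thesis using norm_mean_le[of y] by simp
next
  case False
  then have L: "L > 0" using L_nonneg by simp
  let ?w = "mean_op y"
  have "inner ?w (mean_op ?w) \<le> norm ?w * norm (mean_op ?w)"
    by (rule norm_cauchy_schwarz)
  also have "\<dots> \<le> norm ?w * (L * norm ?w)"
    by (intro mult_left_mono norm_mean_le) simp
  finally have w: "inner ?w (mean_op ?w) \<le> L * (norm ?w)\<^sup>2"
    by (simp add: power2_eq_square algebra_simps)
  have "0 \<le> inner (L *\<^sub>R y - ?w) (mean_op (L *\<^sub>R y - ?w))"
    by (rule psd)
  also have "\<dots> = L * L * inner y ?w - 2 * L * (norm ?w)\<^sup>2 + inner ?w (mean_op ?w)"
    using selfadjoint_mean[of y "?w"]
    by (simp add: linear_diff[OF linear_mean] linear_scale[OF linear_mean] inner_diff_left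
        inner_diff_right power2_norm_eq_inner algebra_simps)
  also have "\<dots> \<le> L * (L * inner y ?w - (norm ?w)\<^sup>2)"
    using w by (simp add: power2_eq_square algebra_simps)
  finally show ?thesis
    using L by (simp add: zero_le_mult_iff)
qed

text \<open>\<open>disp_eq\<close> is inserted once more and self-adjointness moves both operators
  towards \<open>y\<close>. After exchanging the summations, the sum over \<open>i > j\<close> for
  fixed \<open>j\<close> is a partial sum of the permuted family \<open>V a y\<close>, so
  \<open>rms_partial_sum_le\<close> applies to it.\<close>

lemma inner_residual_eq:
  assumes \<pi>: "\<pi> \<in> perms n"
  shows "inner y (residual \<pi> y) = \<eta>\<^sup>2 *
    ((\<Sum>i = 1..n. \<Sum>j = 1..i - 1. inner (V (\<pi> i) y) (V (\<pi> j) y + b (\<pi> j)))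
     + (\<Sum>j = 1..n. inner (V (\<pi> j) (\<Sum>i = j + 1..n. V (\<pi> i) y)) (disp \<pi> y (j - 1))))"
proof -
  have in_range: "i \<in> {1..n} \<Longrightarrow> \<pi> i \<in> {1..n}" for i
    using \<pi> perms_in by blast
  have one: "inner y (V (\<pi> i) (disp \<pi> y (i - 1))) = - \<eta> *
      ((\<Sum>j = 1..i - 1. inner (V (\<pi> i) y) (V (\<pi> j) y + b (\<pi> j)))
       + (\<Sum>j = 1..i - 1. inner (V (\<pi> j) (V (\<pi> i) y)) (disp \<pi> y (j - 1))))"
    if i: "i \<in> {1..n}" for i
  proof -
    have "inner y (V (\<pi> i) (disp \<pi> y (i - 1))) = inner (V (\<pi> i) y) (disp \<pi> y (i - 1))"
      using selfadjoint_V[OF in_range[OF i]] by simp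
    also have "\<dots> = - \<eta> * (inner (V (\<pi> i) y) (\<Sum>j = 1..i - 1. V (\<pi> j) y + b (\<pi> j))
        + inner (V (\<pi> i) y) (\<Sum>j = 1..i - 1. V (\<pi> j) (disp \<pi> y (j - 1))))"
    proof -
      have "i - 1 \<le> n" using i by auto
      from disp_eq[OF \<pi> this, of y] show ?thesis
        by (simp only: inner_scaleR_right inner_add_right)
    qed
    also have "inner (V (\<pi> i) y) (\<Sum>j = 1..i - 1. V (\<pi> j) (disp \<pi> y (j - 1)))
        = (\<Sum>j = 1..i - 1. inner (V (\<pi> j) (V (\<pi> i) y)) (disp \<pi> y (j - 1)))"
      unfolding inner_sum_right
    proof (rule sum.cong[OF refl])
      fix j assume "j \<in> {1..i - 1}"
      then have "j \<in> {1..n}" using i by auto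
      then show "inner (V (\<pi> i) y) (V (\<pi> j) (disp \<pi> y (j - 1)))
          = inner (V (\<pi> j) (V (\<pi> i) y)) (disp \<pi> y (j - 1))"
        using selfadjoint_V in_range by simp
    qed
    finally show ?thesis by (simp only: inner_sum_right)
  qed
  have "(\<Sum>i = 1..n. \<Sum>j = 1..i - 1. inner (V (\<pi> j) (V (\<pi> i) y)) (disp \<pi> y (j - 1)))
      = (\<Sum>j = 1..n. \<Sum>i = j + 1..n. inner (V (\<pi> j) (V (\<pi> i) y)) (disp \<pi> y (j - 1)))"
    by (rule sum_swap_triangle)
  also have "\<dots> = (\<Sum>j = 1..n. inner (V (\<pi> j) (\<Sum>i = j + 1..n. V (\<pi> i) y)) (disp \<pi> y (j - 1)))"
    using linear_V in_range by (intro sum.cong) (simp_all add: linear_sum inner_sum_left)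
  finally have swap: "(\<Sum>i = 1..n. \<Sum>j = 1..i - 1. inner (V (\<pi> j) (V (\<pi> i) y)) (disp \<pi> y (j - 1)))
      = (\<Sum>j = 1..n. inner (V (\<pi> j) (\<Sum>i = j + 1..n. V (\<pi> i) y)) (disp \<pi> y (j - 1)))" .
  have "inner y (residual \<pi> y) = - \<eta> * (\<Sum>i = 1..n. inner y (V (\<pi> i) (disp \<pi> y (i - 1))))"
    by (simp only: residual_def inner_scaleR_right inner_sum_right)
  also have "\<dots> = - \<eta> * (\<Sum>i = 1..n. - \<eta> *
      ((\<Sum>j = 1..i - 1. inner (V (\<pi> i) y) (V (\<pi> j) y + b (\<pi> j)))
       + (\<Sum>j = 1..i - 1. inner (V (\<pi> j) (V (\<pi> i) y)) (disp \<pi> y (j - 1)))))"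
    by (rule arg_cong[where f = "\<lambda>t. - \<eta> * t"], rule sum.cong[OF refl one])
  also have "\<dots> = \<eta>\<^sup>2 * ((\<Sum>i = 1..n. \<Sum>j = 1..i - 1. inner (V (\<pi> i) y) (V (\<pi> j) y + b (\<pi> j)))
       + (\<Sum>i = 1..n. \<Sum>j = 1..i - 1. inner (V (\<pi> j) (V (\<pi> i) y)) (disp \<pi> y (j - 1))))"
    unfolding sum_distrib_left[symmetric] sum.distrib by (simp add: power2_eq_square)
  finally show ?thesis
    unfolding swap .
qed

text \<open>\<open>avg_perms_triangle\<close> leaves the full double sum, which factors into the
  inner product of two total sums, minus the diagonal. There the square of \<open>V a y\<close> has
  a favourable sign, and only its pairing with \<open>b a\<close> has to be bounded.\<close>

lemma avg_first_order_le:
  "2 * avg (perms n) (\<lambda>\<pi>. \<Sum>i = 1..n. \<Sum>j = 1..i - 1. inner (V (\<pi> i) y) (V (\<pi> j) y + b (\<pi> j)))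
    \<le> (real n * norm (mean_op y))\<^sup>2 + real n * L * G * norm y"
proof -
  have "(\<Sum>a = 1..n. \<Sum>c = 1..n. inner (V a y) (V c y + b c))
      = inner (\<Sum>a = 1..n. V a y) (\<Sum>c = 1..n. V c y + b c)"
    unfolding inner_sum_left by (rule sum.cong[OF refl], rule inner_sum_right[symmetric])
  also have "\<dots> = (real n * norm (mean_op y))\<^sup>2"
    unfolding sum_V sum_grad power_mult_distrib power2_norm_eq_inner by (simp add: power2_eq_square)
  finally have full: "(\<Sum>a = 1..n. \<Sum>c = 1..n. inner (V a y) (V c y + b c)) = (real n * norm (mean_op y))\<^sup>2" .
  have "- (\<Sum>a = 1..n. inner (V a y) (V a y + b a)) = (\<Sum>a = 1..n. - inner (V a y) (V a y + b a))"
    by (rule sum_negf[symmetric])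
  also have "\<dots> \<le> (\<Sum>a = 1..n. L * norm y * G)"
  proof (rule sum_mono)
    fix a assume a: "a \<in> {1..n}"
    have "- inner (V a y) (V a y + b a) \<le> - inner (V a y) (b a)"
      by (simp add: inner_add_right)
    also have "\<dots> \<le> norm (V a y) * norm (b a)"
      using Cauchy_Schwarz_ineq2[of "V a y" "b a"] by linarith
    also have "\<dots> \<le> L * norm y * G"
      using a norm_V_le norm_b_le L_nonneg by (intro mult_mono) auto
    finally show "- inner (V a y) (V a y + b a) \<le> L * norm y * G" .
  qed
  finally have "- (\<Sum>a = 1..n. inner (V a y) (V a y + b a)) \<le> real n * L * G * norm y"
    by (simp add: algebra_simps)
  then show ?thesis
    unfolding avg_perms_triangle[where f = "\<lambda>a c. inner (V a y) (V c y + b c)"] full by linarith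
qed

text \<open>Cauchy-Schwarz for each \<open>j\<close>. One factor \<open>\<eta>\<close> is absorbed
  by the partial sum; the other joins \<open>L\<close> and the \<open>n\<close> values of
  \<open>j\<close> to form \<open>\<epsilon>\<close>. That \<open>V (\<pi> j)\<close> is random does
  no harm, as its norm bound is pointwise.\<close>

lemma avg_second_order_le:
  "\<eta>\<^sup>2 * avg (perms n) (\<lambda>\<pi>. \<Sum>j = 1..n. inner (V (\<pi> j) (\<Sum>i = j + 1..n. V (\<pi> i) y)) (disp \<pi> y (j - 1)))
    \<le> \<epsilon> / (1 - \<epsilon>) * spread 0 y * spread G y"
proof -
  let ?D = "spread G y / (1 - \<epsilon>)"
  have "\<eta>\<^sup>2 * avg (perms n) (\<lambda>\<pi>. inner (V (\<pi> j) (\<Sum>i = j + 1..n. V (\<pi> i) y)) (disp \<pi> y (j - 1)))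
      \<le> \<eta> * L * (spread 0 y * ?D)" if j: "j \<in> {1..n}" for j
  proof -
    have part: "\<eta> * rms (perms n) (\<lambda>\<pi>. \<Sum>i = j + 1..n. V (\<pi> i) y) \<le> spread 0 y"
      using norm_V_le by (intro rms_partial_sum_le sum_V) auto
    have "\<eta> * rms (perms n) (\<lambda>\<pi>. V (\<pi> j) (\<Sum>i = j + 1..n. V (\<pi> i) y))
        \<le> \<eta> * (L * rms (perms n) (\<lambda>\<pi>. \<Sum>i = j + 1..n. V (\<pi> i) y))"
      using j by (intro mult_left_mono rms_V_le \<eta>_nonneg) auto
    also have "\<dots> \<le> L * spread 0 y"
      using mult_left_mono[OF part L_nonneg] by (simp add: algebra_simps)
    finally have 1: "\<eta> * rms (perms n) (\<lambda>\<pi>. V (\<pi> j) (\<Sum>i = j + 1..n. V (\<pi> i) y)) \<le> L * spread 0 y" .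
    have 2: "rms (perms n) (\<lambda>\<pi>. disp \<pi> y (j - 1)) \<le> ?D"
      using j by (intro rms_disp_le) auto
    have "\<eta> * avg (perms n) (\<lambda>\<pi>. inner (V (\<pi> j) (\<Sum>i = j + 1..n. V (\<pi> i) y)) (disp \<pi> y (j - 1)))
        \<le> \<eta> * (rms (perms n) (\<lambda>\<pi>. V (\<pi> j) (\<Sum>i = j + 1..n. V (\<pi> i) y))
          * rms (perms n) (\<lambda>\<pi>. disp \<pi> y (j - 1)))"
      by (intro mult_left_mono abs_le_D1[OF avg_inner_le] \<eta>_nonneg)
    also have "\<dots> = (\<eta> * rms (perms n) (\<lambda>\<pi>. V (\<pi> j) (\<Sum>i = j + 1..n. V (\<pi> i) y)))
          * rms (perms n) (\<lambda>\<pi>. disp \<pi> y (j - 1))"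
      by (rule mult.assoc[symmetric])
    also have "\<dots> \<le> L * spread 0 y * ?D"
      by (rule mult_mono[OF 1 2]) (simp_all add: L_nonneg spread_nonneg rms_nonneg)
    finally have "\<eta> * (\<eta> * avg (perms n) (\<lambda>\<pi>. inner (V (\<pi> j) (\<Sum>i = j + 1..n. V (\<pi> i) y)) (disp \<pi> y (j - 1))))
        \<le> \<eta> * (L * spread 0 y * ?D)"
      by (rule mult_left_mono) (rule \<eta>_nonneg)
    then show ?thesis
      by (simp only: power2_eq_square mult.assoc)
  qed
  then have "(\<Sum>j = 1..n. \<eta>\<^sup>2 * avg (perms n)
      (\<lambda>\<pi>. inner (V (\<pi> j) (\<Sum>i = j + 1..n. V (\<pi> i) y)) (disp \<pi> y (j - 1))))
      \<le> (\<Sum>j = 1..n. \<eta> * L * (spread 0 y * ?D))"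
    by (rule sum_mono)
  then show ?thesis
    by (simp add: avg_sum sum_distrib_left[symmetric] algebra_simps)
qed

lemma avg_inner_residual_le:
  "2 * avg (perms n) (\<lambda>\<pi>. inner y (residual \<pi> y)) \<le> (\<eta> * real n * norm (mean_op y))\<^sup>2
    + \<eta>\<^sup>2 * real n * L * G * norm y + 2 * (\<epsilon> / (1 - \<epsilon>)) * spread 0 y * spread G y"
proof -
  let ?f = "\<lambda>\<pi>. \<Sum>i = 1..n. \<Sum>j = 1..i - 1. inner (V (\<pi> i) y) (V (\<pi> j) y + b (\<pi> j))"
  let ?s = "\<lambda>\<pi>. \<Sum>j = 1..n. inner (V (\<pi> j) (\<Sum>i = j + 1..n. V (\<pi> i) y)) (disp \<pi> y (j - 1))"
  have "avg (perms n) (\<lambda>\<pi>. inner y (residual \<pi> y)) = avg (perms n) (\<lambda>\<pi>. \<eta>\<^sup>2 * (?f \<pi> + ?s \<pi>))"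
    by (intro avg_cong inner_residual_eq)
  also have "\<dots> = \<eta>\<^sup>2 * avg (perms n) ?f + \<eta>\<^sup>2 * avg (perms n) ?s"
    unfolding avg_cmult avg_add by (rule distrib_left)
  finally have "2 * avg (perms n) (\<lambda>\<pi>. inner y (residual \<pi> y))
      = \<eta>\<^sup>2 * (2 * avg (perms n) ?f) + 2 * (\<eta>\<^sup>2 * avg (perms n) ?s)"
    by simp
  also have "\<dots> \<le> \<eta>\<^sup>2 * ((real n * norm (mean_op y))\<^sup>2 + real n * L * G * norm y)
      + 2 * (\<epsilon> / (1 - \<epsilon>) * spread 0 y * spread G y)"
    by (intro add_mono mult_left_mono avg_first_order_le avg_second_order_le) auto
  finally show ?thesis
    by (simp add: power_mult_distrib algebra_simps)
qed

text \<open>The square from \<open>iter_eq\<close> is expanded. Of the two terms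
  \<open>(a y)\<^sup>2\<close> one is the square of the gradient step; the other is the first order
  part of the pairing of \<open>y\<close> with the residual.\<close>

lemma avg_iter_le:
  defines "e \<equiv> \<epsilon> / (1 - \<epsilon>)" and "a y \<equiv> \<eta> * real n * norm (mean_op y)"
  shows "avg (perms n) (\<lambda>\<pi>. (norm (iter \<pi> y n))\<^sup>2) \<le> (norm y)\<^sup>2 - 2 * (\<eta> * real n * inner y (mean_op y))
    + 2 * (a y)\<^sup>2 + \<eta>\<^sup>2 * real n * L * G * norm y + 2 * e * spread 0 y * spread G y
    + 2 * a y * (e * spread G y) + (e * spread G y)\<^sup>2"
proof -
  let ?P = "perms n" and ?w = "mean_op y"
  let ?c = "\<eta> * real n"
  let ?t = "(norm y)\<^sup>2 - 2 * ?c * inner y ?w + ?c\<^sup>2 * (norm ?w)\<^sup>2"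
  have "avg ?P (\<lambda>\<pi>. (norm (iter \<pi> y n))\<^sup>2) = avg ?P (\<lambda>\<pi>. ?t + 2 * inner y (residual \<pi> y)
      - 2 * ?c * inner ?w (residual \<pi> y) + (norm (residual \<pi> y))\<^sup>2)"
    by (rule avg_cong, subst iter_eq, assumption, rule norm_diff_add_power2)
  also have "\<dots> = ?t + 2 * avg ?P (\<lambda>\<pi>. inner y (residual \<pi> y))
      - 2 * ?c * avg ?P (\<lambda>\<pi>. inner ?w (residual \<pi> y)) + (rms ?P (\<lambda>\<pi>. residual \<pi> y))\<^sup>2"
    by (simp only: avg_add avg_diff avg_cmult avg_perms_const rms_power2)
  finally have eq: "avg ?P (\<lambda>\<pi>. (norm (iter \<pi> y n))\<^sup>2) = ?t + 2 * avg ?P (\<lambda>\<pi>. inner y (residual \<pi> y))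
      - 2 * ?c * avg ?P (\<lambda>\<pi>. inner ?w (residual \<pi> y)) + (rms ?P (\<lambda>\<pi>. residual \<pi> y))\<^sup>2" .
  have rms_w: "rms ?P (\<lambda>\<pi>. ?w) = norm ?w"
    by (simp add: rms_def avg_perms_const)
  have r: "rms ?P (\<lambda>\<pi>. residual \<pi> y) \<le> e * spread G y"
    unfolding e_def by (rule rms_residual_le)
  have "- avg ?P (\<lambda>\<pi>. inner ?w (residual \<pi> y)) \<le> norm ?w * rms ?P (\<lambda>\<pi>. residual \<pi> y)"
    using abs_le_D2[OF avg_inner_le[of ?P "\<lambda>\<pi>. ?w" "\<lambda>\<pi>. residual \<pi> y"]] rms_w by simp
  also have "\<dots> \<le> norm ?w * (e * spread G y)"
    by (intro mult_left_mono r) simp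
  finally have "2 * ?c * - avg ?P (\<lambda>\<pi>. inner ?w (residual \<pi> y))
      \<le> 2 * ?c * (norm ?w * (e * spread G y))"
    by (rule mult_left_mono) (simp add: \<eta>_nonneg)
  then have cross: "- (2 * ?c * avg ?P (\<lambda>\<pi>. inner ?w (residual \<pi> y))) \<le> 2 * a y * (e * spread G y)"
    by (simp only: a_def mult.assoc mult_minus_right)
  have sq: "(rms ?P (\<lambda>\<pi>. residual \<pi> y))\<^sup>2 \<le> (e * spread G y)\<^sup>2"
    by (rule power_mono[OF r rms_nonneg])
  have res: "2 * avg ?P (\<lambda>\<pi>. inner y (residual \<pi> y)) \<le> (a y)\<^sup>2
      + \<eta>\<^sup>2 * real n * L * G * norm y + 2 * e * spread 0 y * spread G y"
    using avg_inner_residual_le[of y] unfolding a_def e_def .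
  have t: "?t = (norm y)\<^sup>2 - 2 * (?c * inner y ?w) + (a y)\<^sup>2"
    by (simp only: a_def power_mult_distrib mult.assoc)
  have "u - v + A + r - r' + r'' \<le> u - v + 2 * A + B + C + D + E"
    if "r \<le> A + B + C" "- r' \<le> D" "r'' \<le> E" for u v A B C D E r r' r'' :: real
    using that by linarith
  from this[OF res cross sq] show ?thesis
    unfolding eq t .
qed

text \<open>
  The condition \<open>cond\<close> is where the factor \<open>sqrt (\<kappa> / n)\<close> of the lower bound on the number of
  epochs is needed: it absorbs the sampling noise \<open>\<epsilon>\<^sup>2 \<parallel>y\<parallel>\<^sup>2 / n\<close> of the gradients at \<open>y\<close>.
\<close>

lemma epoch_contraction:
  assumes \<mu>: "\<mu> > 0" and \<eta>: "\<eta> > 0"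
    and psd: "\<And>x. inner x (mean_op x) \<ge> 0"
    and strong: "\<mu> * (norm y)\<^sup>2 \<le> inner y (mean_op y)"
    and \<epsilon>: "\<epsilon> \<le> 3 / 16" and cond: "\<epsilon>\<^sup>2 * L \<le> 9 / 256 * real n * \<mu>"
  shows "avg (perms n) (\<lambda>\<pi>. (norm (iter \<pi> y n))\<^sup>2) \<le> (1 - \<eta> * real n * \<mu>) * (norm y)\<^sup>2
    + 11 * (\<epsilon> * \<eta> * G)\<^sup>2 / (\<eta> * real n * \<mu>) + 52 * \<epsilon>\<^sup>2 * \<eta>\<^sup>2 * real n * G\<^sup>2"
proof -
  define e where "e = \<epsilon> / (1 - \<epsilon>)"
  \<comment> \<open>The parts of \<open>spread\<close>: \<open>a\<close> stems from the full
    gradient, \<open>s\<close> from the fluctuation of the operators at \<open>y\<close>, and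
    \<open>h\<close> from that of the vectors \<open>b\<close>.\<close>
  define a where "a = \<eta> * real n * norm (mean_op y)"
  define s where "s = \<eta> * sqrt (real n) * L * norm y"
  define h where "h = \<eta> * sqrt (real n) * G"
  define X where "X = \<eta> * real n * inner y (mean_op y)"
  define \<theta> where "\<theta> = \<eta> * real n * \<mu>"
  have \<epsilon>0: "\<epsilon> \<ge> 0" using L_nonneg \<eta> by simp
  have e0: "e \<ge> 0" and e3: "e \<le> 3 / 13" and e16: "e \<le> 16 / 13 * \<epsilon>"
  proof -
    have inv: "1 / (1 - \<epsilon>) \<le> 16 / 13" using \<epsilon> by (simp add: field_simps)
    show "e \<ge> 0" using \<epsilon>0 \<epsilon> by (simp add: e_def)
    show 1: "e \<le> 16 / 13 * \<epsilon>" using mult_right_mono[OF inv \<epsilon>0] by (simp add: e_def)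
    show "e \<le> 3 / 13" using 1 \<epsilon> by linarith
  qed
  have \<theta>: "\<theta> > 0" using \<mu> \<eta> n_pos by (simp add: \<theta>_def)
  have X: "\<theta> * (norm y)\<^sup>2 \<le> X"
    using mult_left_mono[OF strong, of "\<eta> * real n"] \<eta> by (simp add: \<theta>_def X_def mult.assoc)
  have X0: "X \<ge> 0" using psd[of y] \<eta> by (simp add: X_def)
  have "a\<^sup>2 \<le> (\<eta> * real n)\<^sup>2 * (L * inner y (mean_op y))"
    using norm_mean_power2_le[OF psd, of y] by (simp add: a_def power_mult_distrib mult_left_mono)
  also have "\<dots> = \<epsilon> * X"
    by (simp add: X_def power2_eq_square algebra_simps)
  also have "\<dots> \<le> 3 / 16 * X"
    using \<epsilon> X0 by (rule mult_right_mono)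
  finally have a2: "a\<^sup>2 \<le> 3 / 16 * X" .
  have s2_eq: "real n * s\<^sup>2 = \<epsilon>\<^sup>2 * (norm y)\<^sup>2"
    using n_pos by (simp add: s_def power_mult_distrib power2_eq_square)
  \<comment> \<open>Here \<open>cond\<close> enters; \<open>9 / 208\<close> is
    \<open>16 / 13 * 9 / 256\<close>.\<close>
  have s2: "e * s\<^sup>2 \<le> 9 / 208 * (\<theta> * (norm y)\<^sup>2)"
  proof -
    have "real n * (e * s\<^sup>2) = e * (\<epsilon>\<^sup>2 * (norm y)\<^sup>2)"
      using s2_eq by (simp add: algebra_simps)
    also have "\<dots> \<le> 16 / 13 * \<epsilon> * (\<epsilon>\<^sup>2 * (norm y)\<^sup>2)"
      using e16 by (rule mult_right_mono) simp
    also have "\<dots> = 16 / 13 * (\<eta> * real n) * (norm y)\<^sup>2 * (\<epsilon>\<^sup>2 * L)"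
      by (simp add: algebra_simps)
    also have "\<dots> \<le> 16 / 13 * (\<eta> * real n) * (norm y)\<^sup>2 * (9 / 256 * real n * \<mu>)"
      using \<eta> by (intro mult_left_mono cond) auto
    also have "\<dots> = real n * (9 / 208 * (\<theta> * (norm y)\<^sup>2))"
      by (simp add: \<theta>_def algebra_simps)
    finally show ?thesis using n_pos by simp
  qed
  have sh: "s * h = \<epsilon> * \<eta> * G * norm y"
    using n_pos by (simp add: s_def h_def algebra_simps)
  have spread2: "(spread g y)\<^sup>2 = a\<^sup>2 + (s + \<eta> * sqrt (real n) * g)\<^sup>2" for g
  proof -
    have "(spread g y)\<^sup>2 = \<eta>\<^sup>2 * ((real n * norm (mean_op y))\<^sup>2 + real n * (L * norm y + g)\<^sup>2)"
      by (simp add: spread_def power_mult_distrib)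
    moreover have *: "s + \<eta> * sqrt (real n) * g = \<eta> * sqrt (real n) * (L * norm y + g)"
      by (simp add: s_def algebra_simps)
    ultimately show ?thesis
      unfolding * a_def power_mult_distrib by (simp add: distrib_left)
  qed
  have lin: "\<eta>\<^sup>2 * real n * L * G * norm y = s * h"
    by (simp add: sh power2_eq_square)
  have "avg (perms n) (\<lambda>\<pi>. (norm (iter \<pi> y n))\<^sup>2) \<le> (norm y)\<^sup>2 - 2 * X + 2 * a\<^sup>2 + s * h
      + 2 * e * spread 0 y * spread G y + 2 * a * (e * spread G y) + (e * spread G y)\<^sup>2"
    using avg_iter_le[of y] unfolding e_def a_def X_def lin[symmetric] by simp
  also have "\<dots> \<le> (1 - \<theta>) * (norm y)\<^sup>2 + 11 * (\<epsilon> * \<eta> * G)\<^sup>2 / \<theta> + 34 * e\<^sup>2 * h\<^sup>2"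
  proof (rule epoch_numerics[OF _ _ _ e0 spread_nonneg spread_nonneg \<theta> e3 X a2 s2 sh])
    show "a \<ge> 0" "s \<ge> 0" "h \<ge> 0"
      using \<eta> L_nonneg G_nonneg by (simp_all add: a_def s_def h_def)
    show "(spread 0 y)\<^sup>2 = a\<^sup>2 + s\<^sup>2" "(spread G y)\<^sup>2 = a\<^sup>2 + (s + h)\<^sup>2"
      using spread2[of 0] spread2[of G] by (simp_all add: h_def)
  qed
  also have "34 * e\<^sup>2 * h\<^sup>2 \<le> 52 * \<epsilon>\<^sup>2 * \<eta>\<^sup>2 * real n * G\<^sup>2"
  proof -
    have "e\<^sup>2 \<le> (16 / 13 * \<epsilon>)\<^sup>2" using e16 e0 by (rule power_mono)
    then have "34 * e\<^sup>2 \<le> 34 * (256 / 169) * \<epsilon>\<^sup>2" unfolding power_mult_distrib[of "16 / 13" "\<epsilon>"] by (simp add: power_divide)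
    \<comment> \<open>The factor \<open>34 * 256 / 169\<close> is about 51.5.\<close>
    also have "\<dots> \<le> 52 * \<epsilon>\<^sup>2" by (rule mult_right_mono) simp_all
    finally have "34 * e\<^sup>2 \<le> 52 * \<epsilon>\<^sup>2" .
    then have "34 * e\<^sup>2 * h\<^sup>2 \<le> 52 * \<epsilon>\<^sup>2 * h\<^sup>2" by (rule mult_right_mono) simp
    then show ?thesis by (simp add: h_def power_mult_distrib mult.assoc)
  qed
  finally show ?thesis by (simp add: \<theta>_def)
qed

end

subsection \<open>Real vectors of all dimensions in one inner product space\<close>

text \<open>
  The dimension of \<open>real Matrix.vec\<close> is not part of the type, so that type is no instance of
  \<open>real_inner\<close>. Finitely supported sequences contain the vectors of every dimension.
\<close>

typedef fseq = "{f :: nat \<Rightarrow> real. finite {i. f i \<noteq> 0}}"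
  morphisms coord fseq
  by (rule exI[of _ "\<lambda>_. 0"]) simp

lemma finite_support: "finite {i. coord x i \<noteq> 0}"
  using coord[of x] by simp

lemma fseq_eqI: "(\<And>i. coord x i = coord y i) \<Longrightarrow> x = y"
  by (simp add: coord_inject[symmetric] ext)

instantiation fseq :: real_vector
begin

definition zero_fseq :: fseq where "0 = fseq (\<lambda>_. 0)"
definition plus_fseq :: "fseq \<Rightarrow> fseq \<Rightarrow> fseq" where "x + y = fseq (\<lambda>i. coord x i + coord y i)"
definition minus_fseq :: "fseq \<Rightarrow> fseq \<Rightarrow> fseq" where "x - y = fseq (\<lambda>i. coord x i - coord y i)"
definition uminus_fseq :: "fseq \<Rightarrow> fseq" where "- x = fseq (\<lambda>i. - coord x i)"
definition scaleR_fseq :: "real \<Rightarrow> fseq \<Rightarrow> fseq" where "c *\<^sub>R x = fseq (\<lambda>i. c * coord x i)"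

lemma coord_simps:
  "coord 0 i = 0" "coord (x + y) i = coord x i + coord y i" "coord (x - y) i = coord x i - coord y i"
  "coord (- x) i = - coord x i" "coord (c *\<^sub>R x) i = c * coord x i"
proof -
  show "coord 0 i = 0"
    unfolding zero_fseq_def by (subst fseq_inverse) auto
  have "finite {i. coord x i + coord y i \<noteq> 0}" "finite {i. coord x i - coord y i \<noteq> 0}"
    by (rule finite_subset[of _ "{i. coord x i \<noteq> 0} \<union> {i. coord y i \<noteq> 0}"];
        auto simp: finite_support)+
  then show "coord (x + y) i = coord x i + coord y i" "coord (x - y) i = coord x i - coord y i"
    unfolding plus_fseq_def minus_fseq_def by (simp_all add: fseq_inverse)
  show "coord (- x) i = - coord x i"
    unfolding uminus_fseq_def by (subst fseq_inverse) (auto simp: finite_support)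
  have "finite {i. c * coord x i \<noteq> 0}"
    by (rule finite_subset[of _ "{i. coord x i \<noteq> 0}"]) (auto simp: finite_support)
  then show "coord (c *\<^sub>R x) i = c * coord x i"
    unfolding scaleR_fseq_def by (simp add: fseq_inverse)
qed

instance
  by standard (auto intro!: fseq_eqI simp: coord_simps algebra_simps)

end

instantiation fseq :: real_inner
begin

text \<open>The support of \<open>x\<close> alone is finite and already carries every nonzero
  product. \<open>inner_fseq_eq\<close> restores the symmetry between both arguments.\<close>

definition inner_fseq :: "fseq \<Rightarrow> fseq \<Rightarrow> real" where
  "inner_fseq x y = (\<Sum>i | coord x i \<noteq> 0. coord x i * coord y i)"
definition norm_fseq :: "fseq \<Rightarrow> real" where "norm_fseq x = sqrt (inner x x)"
definition sgn_fseq :: "fseq \<Rightarrow> fseq" where "sgn_fseq x = x /\<^sub>R norm x"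
definition dist_fseq :: "fseq \<Rightarrow> fseq \<Rightarrow> real" where "dist_fseq x y = norm (x - y)"
definition uniformity_fseq :: "(fseq \<times> fseq) filter" where
  "uniformity_fseq = (INF e\<in>{0<..}. principal {(x, y). dist x y < e})"
definition open_fseq :: "fseq set \<Rightarrow> bool" where
  "open_fseq U \<longleftrightarrow> (\<forall>x\<in>U. eventually (\<lambda>(x', y). x' = x \<longrightarrow> y \<in> U) uniformity)"

lemma inner_fseq_eq:
  assumes "finite S" and "\<And>i. i \<notin> S \<Longrightarrow> coord x i = 0 \<or> coord y i = 0"
  shows "inner x y = (\<Sum>i\<in>S. coord x i * coord y i)"
proof -
  have "inner x y = (\<Sum>i\<in>{i. coord x i \<noteq> 0} \<inter> S. coord x i * coord y i)"
    unfolding inner_fseq_def using assms by (intro sum.mono_neutral_right) (auto simp: finite_support)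
  also have "\<dots> = (\<Sum>i\<in>S. coord x i * coord y i)"
    using assms by (intro sum.mono_neutral_left) auto
  finally show ?thesis .
qed

instance
proof
  fix x y z :: fseq and r :: real
  let ?S = "{i. coord x i \<noteq> 0} \<union> {i. coord y i \<noteq> 0}"
  have fin: "finite ?S" by (simp add: finite_support)
  have eq: "inner u v = (\<Sum>i\<in>?S. coord u i * coord v i)"
    if "\<And>i. coord x i = 0 \<and> coord y i = 0 \<Longrightarrow> coord u i = 0 \<or> coord v i = 0" for u v
    by (rule inner_fseq_eq[OF fin]) (use that in auto)
  show "inner x y = inner y x"
    using eq[of x y] eq[of y x] by (simp add: mult.commute)
  show "inner (x + y) z = inner x z + inner y z"
    using eq[of "x + y" z] eq[of x z] eq[of y z]
    by (simp add: coord_simps distrib_right sum.distrib)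
  show "inner (r *\<^sub>R x) y = r * inner x y"
    using eq[of "r *\<^sub>R x" y] eq[of x y]
    by (simp add: coord_simps sum_distrib_left mult.assoc)
  show "0 \<le> inner x x"
    by (simp add: inner_fseq_def sum_nonneg)
  show "inner x x = 0 \<longleftrightarrow> x = 0"
  proof
    assume "inner x x = 0"
    then have "\<forall>i\<in>{i. coord x i \<noteq> 0}. coord x i * coord x i = 0"
      unfolding inner_fseq_def by (subst (asm) sum_nonneg_eq_0_iff) (auto simp: finite_support)
    then show "x = 0" by (intro fseq_eqI) (auto simp: coord_simps)
  qed (simp add: inner_fseq_def coord_simps)
qed (simp_all add: sgn_fseq_def dist_fseq_def norm_fseq_def uniformity_fseq_def open_fseq_def)

end

section \<open>Zero padding and truncation between vectors and sequences\<close>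

definition emb :: "real Matrix.vec \<Rightarrow> fseq" where
  "emb v = fseq (\<lambda>i. if i < dim_vec v then vec_index v i else 0)"

definition proj :: "nat \<Rightarrow> fseq \<Rightarrow> real Matrix.vec" where
  "proj d x = Matrix.vec d (coord x)"

lemma coord_emb: "coord (emb v) i = (if i < dim_vec v then vec_index v i else 0)"
proof -
  have "finite {i. (if i < dim_vec v then vec_index v i else 0) \<noteq> 0}"
    by (rule finite_subset[of _ "{..<dim_vec v}"]) auto
  then show ?thesis by (simp add: emb_def fseq_inverse)
qed

lemma proj_carrier [simp]: "proj d x \<in> carrier_vec d"
  by (simp add: proj_def)

lemma proj_emb [simp]: "v \<in> carrier_vec d \<Longrightarrow> proj d (emb v) = v"
  by (auto simp: proj_def coord_emb)

lemma proj_add: "proj d (x + y) = proj d x + proj d y"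
  and proj_scaleR: "proj d (c *\<^sub>R x) = c \<cdot>\<^sub>v proj d x"
  by (auto simp: proj_def coord_simps)

lemma emb_add: "u \<in> carrier_vec d \<Longrightarrow> v \<in> carrier_vec d \<Longrightarrow> emb (u + v) = emb u + emb v"
  and emb_diff: "u \<in> carrier_vec d \<Longrightarrow> v \<in> carrier_vec d \<Longrightarrow> emb (u - v) = emb u - emb v"
  and emb_smult: "emb (c \<cdot>\<^sub>v v) = c *\<^sub>R emb v"
  by (auto intro!: fseq_eqI simp: coord_emb coord_simps)

text \<open>\<open>emb\<close> and \<open>proj d\<close> are adjoint to each other. This turns
  symmetry of a matrix into self-adjointness of the operator on sequences.\<close>

lemma inner_emb: "v \<in> carrier_vec d \<Longrightarrow> inner (emb v) x = scalar_prod v (proj d x)"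
  by (subst inner_fseq_eq[of "{0..<d}"]) (auto simp: coord_emb scalar_prod_def proj_def)

lemma norm_emb: "norm (emb v) = euclid_norm v"
  by (simp add: norm_eq_sqrt_inner inner_emb[of v "dim_vec v"] euclid_norm_def)

lemma norm_emb_proj_le: "norm (emb (proj d x)) \<le> norm x"
proof -
  have "(norm (emb (proj d x)))\<^sup>2 = inner (emb (proj d x)) x"
    by (simp add: power2_norm_eq_inner inner_emb[of _ d])
  also have "\<dots> \<le> norm (emb (proj d x)) * norm x"
    by (rule norm_cauchy_schwarz)
  finally show ?thesis
    by (cases "norm (emb (proj d x)) = 0") (simp_all add: power2_eq_square)
qed

lemma euclid_norm_eq_L2_set: "euclid_norm v = L2_set (vec_index v) {0..<dim_vec v}"
  by (simp add: euclid_norm_def L2_set_def scalar_prod_def power2_eq_square)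

lemma euclid_norm_nonneg: "0 \<le> euclid_norm v"
  by (simp add: norm_emb[symmetric])

lemma euclid_norm_power2: "(euclid_norm v)\<^sup>2 = scalar_prod v v"
  using power2_norm_eq_inner[of "emb v"] by (simp add: norm_emb inner_emb[of v "dim_vec v"])

lemma euclid_norm_eq_0: "x \<in> carrier_vec d \<Longrightarrow> euclid_norm x = 0 \<Longrightarrow> x = 0\<^sub>v d"
  using norm_emb[of x] proj_emb[of x d] by (auto simp: proj_def coord_simps)

subsection \<open>The spectral norm\<close>

text \<open>A real supremum is an upper bound only if the set is bounded above. Here the sum of the
  absolute values of all entries is a bound, since a vector in the unit ball has coordinates of
  absolute value at most 1.\<close>

lemma bdd_above_spectral_norm:
  "bdd_above ((\<lambda>v. euclid_norm (M *\<^sub>v v)) ` {v \<in> carrier_vec (dim_col M). euclid_norm v \<le> 1})"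
proof (rule bdd_aboveI2)
  fix v assume "v \<in> {v \<in> carrier_vec (dim_col M). euclid_norm v \<le> 1}"
  then have v: "dim_vec v = dim_col M" "euclid_norm v \<le> 1" by auto
  have v_le: "\<bar>vec_index v j\<bar> \<le> 1" if "j < dim_col M" for j
  proof -
    have "\<bar>vec_index v j\<bar> \<le> L2_set (\<lambda>i. \<bar>vec_index v i\<bar>) {0..<dim_vec v}"
      using that v by (intro member_le_L2_set) auto
    also have "\<dots> = euclid_norm v" by (simp add: euclid_norm_eq_L2_set L2_set_def)
    finally show ?thesis using v by linarith
  qed
  have "euclid_norm (M *\<^sub>v v) \<le> (\<Sum>i\<in>{0..<dim_row M}. \<bar>vec_index (M *\<^sub>v v) i\<bar>)"
    unfolding euclid_norm_eq_L2_set dim_mult_mat_vec by (rule L2_set_le_sum_abs)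
  also have "\<dots> \<le> (\<Sum>i\<in>{0..<dim_row M}. \<Sum>j\<in>{0..<dim_col M}. \<bar>M $$ (i, j)\<bar>)"
  proof (rule sum_mono)
    fix i assume i: "i \<in> {0..<dim_row M}"
    have "\<bar>vec_index (M *\<^sub>v v) i\<bar> \<le> (\<Sum>j\<in>{0..<dim_col M}. \<bar>M $$ (i, j) * vec_index v j\<bar>)"
      using i v by (simp add: scalar_prod_def row_def sum_abs)
    also have "\<dots> \<le> (\<Sum>j\<in>{0..<dim_col M}. \<bar>M $$ (i, j)\<bar>)"
      using v_le by (intro sum_mono) (auto simp: abs_mult intro: mult_left_le)
    finally show "\<bar>vec_index (M *\<^sub>v v) i\<bar> \<le> (\<Sum>j\<in>{0..<dim_col M}. \<bar>M $$ (i, j)\<bar>)" .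
  qed
  finally show "euclid_norm (M *\<^sub>v v) \<le> (\<Sum>i\<in>{0..<dim_row M}. \<Sum>j\<in>{0..<dim_col M}. \<bar>M $$ (i, j)\<bar>)" .
qed

lemma euclid_norm_smult: "euclid_norm (c \<cdot>\<^sub>v v) = \<bar>c\<bar> * euclid_norm v"
  by (simp add: norm_emb[symmetric] emb_smult)

lemma euclid_norm_mult_le_spectral_norm:
  assumes M: "M \<in> carrier_mat m d" and v: "v \<in> carrier_vec d"
  shows "euclid_norm (M *\<^sub>v v) \<le> spectral_norm M * euclid_norm v"
proof (cases "euclid_norm v = 0")
  case True
  then have "v = 0\<^sub>v d"
    using v norm_emb[of v] proj_emb[OF v] by (auto simp: proj_def coord_simps)
  moreover have "M *\<^sub>v 0\<^sub>v d = 0\<^sub>v m" using M by auto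
  moreover have "euclid_norm (0\<^sub>v m) = 0" by (simp add: euclid_norm_def)
  ultimately show ?thesis using True by simp
next
  case False
  then have pos: "euclid_norm v > 0" using euclid_norm_nonneg[of v] by simp
  let ?u = "(1 / euclid_norm v) \<cdot>\<^sub>v v"
  have "euclid_norm ?u = 1" using pos by (simp add: euclid_norm_smult)
  moreover have "?u \<in> carrier_vec (dim_col M)" using M v by auto
  ultimately have "euclid_norm (M *\<^sub>v ?u) \<le> spectral_norm M"
    unfolding spectral_norm_def using bdd_above_spectral_norm by (intro cSUP_upper) auto
  moreover have "M *\<^sub>v ?u = (1 / euclid_norm v) \<cdot>\<^sub>v (M *\<^sub>v v)"
    using M v by (rule mult_mat_vec)
  ultimately show ?thesis
    using pos by (simp add: euclid_norm_smult field_simps)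
qed

subsection \<open>Gradients of quadratic functions\<close>

lemma scalar_prod_mult_mat_vec:
  fixes M :: "'a::comm_semiring_0 Matrix.mat"
  assumes "M \<in> carrier_mat d d" "v \<in> carrier_vec d"
  shows "scalar_prod v (M *\<^sub>v v)
    = (\<Sum>i\<in>{0..<d}. \<Sum>j\<in>{0..<d}. vec_index v i * (M $$ (i, j) * vec_index v j))"
  using assms by (auto simp: scalar_prod_def row_def sum_distrib_left intro!: sum.cong)

lemma scalar_prod_symmetric_mat:
  assumes "M \<in> carrier_mat d d" "symmetric_mat M" "x \<in> carrier_vec d" "y \<in> carrier_vec d"
  shows "scalar_prod (M *\<^sub>v x) y = scalar_prod x (M *\<^sub>v y)"
  using transpose_vec_mult_scalar[of M d d y x] assms by (simp add: symmetric_mat_def)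

text \<open>Along a coordinate direction the function is a polynomial of degree at most 2 in
  \<open>t\<close>. Symmetry of \<open>M\<close> merges its two mixed terms, and the linear
  coefficient is the partial derivative.\<close>

lemma gradient_quadratic:
  assumes M: "M \<in> carrier_mat d d" "symmetric_mat M" and b: "b \<in> carrier_vec d"
    and x: "x \<in> carrier_vec d"
  shows "gradient (quadratic M b) x = M *\<^sub>v x + b"
proof (rule eq_vecI)
  show "dim_vec (gradient (quadratic M b) x) = dim_vec (M *\<^sub>v x + b)"
    using x b by (simp add: gradient_def)
  fix j assume "j < dim_vec (M *\<^sub>v x + b)"
  then have j: "j < d" using b by simp
  let ?e = "unit_vec d j"
  have e: "?e \<in> carrier_vec d" by simp
  have Mx: "M *\<^sub>v x \<in> carrier_vec d" and Me: "M *\<^sub>v ?e \<in> carrier_vec d" using M x by auto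
  let ?g = "vec_index (M *\<^sub>v x + b) j" and ?h = "scalar_prod ?e (M *\<^sub>v ?e)"
  have 1: "scalar_prod x (M *\<^sub>v ?e) = vec_index (M *\<^sub>v x) j"
    using scalar_prod_symmetric_mat[OF M x e] Mx j by simp
  have "quadratic M b (x + t \<cdot>\<^sub>v ?e) = quadratic M b x + t * ?g + t\<^sup>2 * (?h / 2)" for t
  proof -
    have "M *\<^sub>v (x + t \<cdot>\<^sub>v ?e) = M *\<^sub>v x + t \<cdot>\<^sub>v (M *\<^sub>v ?e)"
      using M x e by (simp add: mult_add_distrib_mat_vec[of _ d d] mult_mat_vec[of _ d d])
    moreover have "scalar_prod (x + t \<cdot>\<^sub>v ?e) (M *\<^sub>v x + t \<cdot>\<^sub>v (M *\<^sub>v ?e))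
        = scalar_prod x (M *\<^sub>v x) + 2 * t * vec_index (M *\<^sub>v x) j + t\<^sup>2 * ?h"
      using x e Mx Me j M
      by (simp add: add_scalar_prod_distrib[of _ d] scalar_prod_add_distrib[of _ d] 1
          power2_eq_square algebra_simps)
    moreover have "scalar_prod b (x + t \<cdot>\<^sub>v ?e) = scalar_prod b x + t * vec_index b j"
      using b x e j by (simp add: scalar_prod_add_distrib[of _ d])
    moreover have "?g = vec_index (M *\<^sub>v x) j + vec_index b j"
      using j b by simp
    ultimately show ?thesis
      by (simp add: quadratic_def algebra_simps)
  qed
  then have "((\<lambda>t. quadratic M b (x + t \<cdot>\<^sub>v ?e)) has_field_derivative ?g) (at 0)"
    by (auto intro!: derivative_eq_intros)
  then have "deriv (\<lambda>t. quadratic M b (x + t \<cdot>\<^sub>v ?e)) 0 = ?g"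
    by (rule DERIV_imp_deriv)
  then show "vec_index (gradient (quadratic M b) x) j = ?g"
    using x j by (simp add: gradient_def)
qed

subsection \<open>Random shuffling on quadratic functions\<close>

lemma set_shuffle_pmf:
  assumes "\<sigma> \<in> set_pmf (shuffle_pmf n k)" "j \<in> {1..k}"
  shows "\<sigma> j \<in> perms n"
proof -
  have "set_pmf (pmf_of_set {\<pi>. \<pi> permutes {1..n}}) = perms n"
    using perms_nonempty[of n] finite_perms[of n] unfolding perms_def by (rule set_pmf_of_set)
  then show ?thesis
    using assms by (auto simp: shuffle_pmf_def set_Pi_pmf PiE_dflt_def)
qed

text \<open>Finite support makes every real function integrable, so linearity and monotonicity of
  the expectation apply at once.\<close>

lemma finite_set_shuffle_pmf: "finite (set_pmf (shuffle_pmf n k))"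
proof -
  have "set_pmf (pmf_of_set {\<pi>. \<pi> permutes {1..n}}) = perms n"
    using perms_nonempty[of n] finite_perms[of n] unfolding perms_def by (rule set_pmf_of_set)
  then show ?thesis
    using finite_perms[of n] unfolding shuffle_pmf_def
    by (subst set_Pi_pmf) (auto intro!: finite_PiE_dflt)
qed

text \<open>The last permutation is independent of the earlier ones: averaging over it first is
  conditioning on the past epochs.\<close>

lemma expectation_shuffle_pmf_Suc:
  fixes h :: "(nat \<Rightarrow> nat \<Rightarrow> nat) \<Rightarrow> real"
  shows "measure_pmf.expectation (shuffle_pmf n (Suc k)) h
    = measure_pmf.expectation (shuffle_pmf n k) (\<lambda>\<sigma>. avg (perms n) (\<lambda>\<pi>. h (\<sigma>(Suc k := \<pi>))))"
proof -
  have insert: "{1..Suc k} = insert (Suc k) {1..k}" by auto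
  have "shuffle_pmf n (Suc k)
      = pmf_of_set (perms n) \<bind> (\<lambda>\<pi>. map_pmf (\<lambda>\<sigma>. \<sigma>(Suc k := \<pi>)) (shuffle_pmf n k))"
    unfolding shuffle_pmf_def perms_def map_pmf_def insert
    by (rule Pi_pmf_insert') auto
  then have "measure_pmf.expectation (shuffle_pmf n (Suc k)) h
      = (\<Sum>\<pi>\<in>perms n. measure_pmf.expectation (map_pmf (\<lambda>\<sigma>. \<sigma>(Suc k := \<pi>)) (shuffle_pmf n k)) h
          /\<^sub>R real (card (perms n)))"
    by (simp add: pmf_expectation_bind_pmf_of_set finite_perms perms_nonempty finite_set_shuffle_pmf)
  also have "\<dots> = (\<Sum>\<pi>\<in>perms n. measure_pmf.expectation (shuffle_pmf n k)
      (\<lambda>\<sigma>. h (\<sigma>(Suc k := \<pi>)) / real (card (perms n))))"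
    by (simp add: divide_inverse mult.commute)
  also have "\<dots> = measure_pmf.expectation (shuffle_pmf n k)
      (\<lambda>\<sigma>. \<Sum>\<pi>\<in>perms n. h (\<sigma>(Suc k := \<pi>)) / real (card (perms n)))"
    by (rule Bochner_Integration.integral_sum[symmetric])
       (rule integrable_measure_pmf_finite[OF finite_set_shuffle_pmf])
  finally show ?thesis
    by (simp add: avg_def sum_divide_distrib)
qed

lemma expectation_shuffle_pmf_mono:
  fixes g h :: "(nat \<Rightarrow> nat \<Rightarrow> nat) \<Rightarrow> real"
  assumes "\<And>\<sigma>. \<sigma> \<in> set_pmf (shuffle_pmf n k) \<Longrightarrow> g \<sigma> \<le> h \<sigma>"
  shows "measure_pmf.expectation (shuffle_pmf n k) g \<le> measure_pmf.expectation (shuffle_pmf n k) h"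
  using assms
  by (intro integral_mono_AE integrable_measure_pmf_finite finite_set_shuffle_pmf)
     (auto simp: AE_measure_pmf_iff)

lemma random_shuffle_upd:
  "k < j \<Longrightarrow> random_shuffle n f \<eta> (\<sigma>(j := \<pi>)) x k = random_shuffle n f \<eta> \<sigma> x k"
  by (induction k) auto

section \<open>The concrete problem, its embedding and its minimizer\<close>

locale quadratic_problem =
  fixes n d :: nat and A :: "nat \<Rightarrow> real Matrix.mat" and b :: "nat \<Rightarrow> real Matrix.vec"
    and L G \<mu> :: real
  assumes n_ge_2: "n \<ge> 2" and d_ge_1: "d \<ge> 1" and L_pos: "L > 0" and \<mu>_pos: "\<mu> > 0"
    and A_carrier: "i \<in> {1..n} \<Longrightarrow> A i \<in> carrier_mat d d"
    and A_symmetric: "i \<in> {1..n} \<Longrightarrow> symmetric_mat (A i)"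
    and b_carrier: "i \<in> {1..n} \<Longrightarrow> b i \<in> carrier_vec d"
    and A_norm: "i \<in> {1..n} \<Longrightarrow> spectral_norm (A i) \<le> L"
    and b_norm: "i \<in> {1..n} \<Longrightarrow> euclid_norm (b i) \<le> G"
    and mean_quadratic: "x \<in> carrier_vec d \<Longrightarrow> mean_fun n (\<lambda>i. quadratic (A i) (b i)) x
      = 1 / 2 * scalar_prod x (mean_mat d n A *\<^sub>v x)"
    and strong: "pos_semidef (mean_mat d n A - \<mu> \<cdot>\<^sub>m 1\<^sub>m d)"
begin

abbreviation f :: "nat \<Rightarrow> real Matrix.vec \<Rightarrow> real" where
  "f i \<equiv> quadratic (A i) (b i)"

definition F :: "real Matrix.vec \<Rightarrow> real" where
  "F = mean_fun n f"

definition mat_op :: "nat \<Rightarrow> fseq \<Rightarrow> fseq" where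
  "mat_op i x = emb (A i *\<^sub>v proj d x)"

definition emb_b :: "nat \<Rightarrow> fseq" where
  "emb_b i = emb (b i)"

lemma A_mult_carrier [simp]: "i \<in> {1..n} \<Longrightarrow> v \<in> carrier_vec d \<Longrightarrow> A i *\<^sub>v v \<in> carrier_vec d"
  using A_carrier by (rule mult_mat_vec_carrier)

lemma mean_mat_carrier: "mean_mat d n A \<in> carrier_mat d d"
  by (simp add: mean_mat_def)

lemma mean_form_eq:
  assumes v: "v \<in> carrier_vec d"
  shows "scalar_prod v (mean_mat d n A *\<^sub>v v) = (\<Sum>a = 1..n. scalar_prod v (A a *\<^sub>v v)) / real n"
proof -
  have "scalar_prod v (mean_mat d n A *\<^sub>v v) = (\<Sum>i\<in>{0..<d}. \<Sum>j\<in>{0..<d}. \<Sum>a = 1..n.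
      vec_index v i * (A a $$ (i, j) * vec_index v j) / real n)"
    unfolding scalar_prod_mult_mat_vec[OF mean_mat_carrier v]
    by (intro sum.cong) (auto simp: mean_mat_def sum_distrib_left sum_distrib_right algebra_simps)
  also have "\<dots> = (\<Sum>i\<in>{0..<d}. \<Sum>a = 1..n. \<Sum>j\<in>{0..<d}.
      vec_index v i * (A a $$ (i, j) * vec_index v j) / real n)"
    by (intro sum.cong sum.swap refl)
  also have "\<dots> = (\<Sum>a = 1..n. \<Sum>i\<in>{0..<d}. \<Sum>j\<in>{0..<d}.
      vec_index v i * (A a $$ (i, j) * vec_index v j) / real n)"
    by (rule sum.swap)
  also have "\<dots> = (\<Sum>a = 1..n. scalar_prod v (A a *\<^sub>v v) / real n)"
    by (intro sum.cong refl) (simp add: scalar_prod_mult_mat_vec[OF A_carrier v] sum_divide_distrib)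
  finally show ?thesis
    by (simp add: sum_divide_distrib)
qed

lemma mean_form_ge:
  assumes v: "v \<in> carrier_vec d"
  shows "\<mu> * (euclid_norm v)\<^sup>2 \<le> scalar_prod v (mean_mat d n A *\<^sub>v v)"
proof -
  let ?M = "mean_mat d n A"
  have "row (\<mu> \<cdot>\<^sub>m 1\<^sub>m d) i = \<mu> \<cdot>\<^sub>v unit_vec d i" if "i < d" for i
    using that by auto
  then have "(\<mu> \<cdot>\<^sub>m 1\<^sub>m d) *\<^sub>v v = \<mu> \<cdot>\<^sub>v v"
    using v by (intro eq_vecI) auto
  then have "(?M - \<mu> \<cdot>\<^sub>m 1\<^sub>m d) *\<^sub>v v = ?M *\<^sub>v v - \<mu> \<cdot>\<^sub>v v"
    using v mean_mat_carrier by (subst minus_mult_distrib_mat_vec[of _ d d]) auto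
  moreover have "0 \<le> scalar_prod v ((?M - \<mu> \<cdot>\<^sub>m 1\<^sub>m d) *\<^sub>v v)"
    using strong v by (simp add: pos_semidef_def)
  ultimately show ?thesis
    using v mean_mat_carrier by (simp add: scalar_prod_minus_distrib[of _ d] euclid_norm_power2)
qed

lemma norm_mat_op_le: "i \<in> {1..n} \<Longrightarrow> norm (mat_op i x) \<le> L * norm x"
proof -
  assume i: "i \<in> {1..n}"
  have "norm (mat_op i x) \<le> spectral_norm (A i) * euclid_norm (proj d x)"
    unfolding mat_op_def norm_emb by (rule euclid_norm_mult_le_spectral_norm[OF A_carrier[OF i]]) simp
  also have "\<dots> \<le> L * norm x"
    using A_norm[OF i] L_pos norm_emb_proj_le[of d x]
    by (intro mult_mono) (auto simp: norm_emb euclid_norm_nonneg)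
  finally show ?thesis .
qed

text \<open>Comparing \<open>mean_quadratic\<close> with the average of the quadratics removes the
  linear part at every \<open>x\<close>. At \<open>x\<close> equal to the sum of the
  \<open>b i\<close> itself, this says that its squared norm is 0.\<close>

lemma sum_emb_b: "(\<Sum>a = 1..n. emb_b a) = 0"
proof -
  have zero: "(\<Sum>a = 1..n. scalar_prod (b a) x) = 0" if x: "x \<in> carrier_vec d" for x
    using mean_quadratic[OF x] n_ge_2
    by (simp add: mean_form_eq[OF x] mean_fun_def quadratic_def sum.distrib sum_divide_distrib[symmetric]
        sum_distrib_left[symmetric] field_simps)
  have "inner (\<Sum>a = 1..n. emb_b a) (\<Sum>a = 1..n. emb_b a)
      = (\<Sum>a = 1..n. scalar_prod (b a) (proj d (\<Sum>a = 1..n. emb_b a)))"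
    unfolding inner_sum_left
    by (rule sum.cong) (auto simp: emb_b_def inner_emb[OF b_carrier])
  also have "\<dots> = 0" by (rule zero) simp
  finally show ?thesis by simp
qed

lemma shuffled_quadratics:
  assumes "\<eta> \<ge> 0" "\<eta> * real n * L < 1"
  shows "shuffled_quadratics n mat_op emb_b L G \<eta>"
proof (rule shuffled_quadratics.intro)
  show "n > 0" "L \<ge> 0" using n_ge_2 L_pos by auto
  fix a assume a: "a \<in> {1..n}"
  show "linear (mat_op a)"
  proof (rule linearI)
    show "mat_op a (x + y) = mat_op a x + mat_op a y" for x y
      using a by (simp add: mat_op_def proj_add mult_add_distrib_mat_vec[OF A_carrier] emb_add[of _ d])
    show "mat_op a (r *\<^sub>R x) = r *\<^sub>R mat_op a x" for r x
      using a by (simp add: mat_op_def proj_scaleR mult_mat_vec[OF A_carrier] emb_smult)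
  qed
  fix x y
  show "inner (mat_op a x) y = inner x (mat_op a y)"
    using a scalar_prod_symmetric_mat[OF A_carrier[OF a] A_symmetric[OF a], of "proj d x" "proj d y"]
      comm_scalar_prod[of "proj d x" d "A a *\<^sub>v proj d y"]
    by (simp add: mat_op_def inner_emb[of _ d] inner_commute[of x])
  show "norm (mat_op a x) \<le> L * norm x"
    by (rule norm_mat_op_le[OF a])
  show "norm (emb_b a) \<le> G"
    using b_norm[OF a] by (simp add: emb_b_def norm_emb)
qed (use assms sum_emb_b in auto)

lemma inner_mean_op:
  "inner x (shuffled_quadratics.mean_op n mat_op x) = scalar_prod (proj d x) (mean_mat d n A *\<^sub>v proj d x)"
proof -
  \<comment> \<open>\<open>mean_op\<close> does not depend on the step size, and 0 satisfies the
    assumptions on it.\<close>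
  interpret shuffled_quadratics n mat_op emb_b L G 0
    by (rule shuffled_quadratics) auto
  have "inner x (mean_op x) = (\<Sum>a = 1..n. inner (mat_op a x) x) / real n"
    by (simp add: mean_op_def inner_sum_right inner_commute)
  also have "(\<Sum>a = 1..n. inner (mat_op a x) x) = (\<Sum>a = 1..n. scalar_prod (proj d x) (A a *\<^sub>v proj d x))"
    by (rule sum.cong) (auto simp: mat_op_def inner_emb[of _ d] intro!: comm_scalar_prod[of _ d])
  finally show ?thesis by (simp add: mean_form_eq)
qed

lemma mean_form_le:
  assumes v: "v \<in> carrier_vec d"
  shows "scalar_prod v (mean_mat d n A *\<^sub>v v) \<le> L * (euclid_norm v)\<^sup>2"
proof -
  interpret shuffled_quadratics n mat_op emb_b L G 0
    by (rule shuffled_quadratics) auto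
  have "scalar_prod v (mean_mat d n A *\<^sub>v v) = inner (emb v) (mean_op (emb v))"
    using v by (simp add: inner_mean_op)
  also have "\<dots> \<le> norm (emb v) * norm (mean_op (emb v))"
    by (rule norm_cauchy_schwarz)
  also have "\<dots> \<le> norm (emb v) * (L * norm (emb v))"
    by (intro mult_left_mono norm_mean_le) simp
  finally show ?thesis by (simp add: norm_emb power2_eq_square algebra_simps)
qed

text \<open>The upper and the lower bound on the mean form meet at a unit vector, which exists
  because \<open>d \<ge> 1\<close>. This yields \<open>\<theta> \<le> 1\<close> later.\<close>

lemma \<mu>_le_L: "\<mu> \<le> L"
proof -
  let ?e = "unit_vec d 0 :: real Matrix.vec"
  have "\<mu> * (euclid_norm ?e)\<^sup>2 \<le> L * (euclid_norm ?e)\<^sup>2"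
    using mean_form_ge[of ?e] mean_form_le[of ?e] by simp
  moreover have "(euclid_norm ?e)\<^sup>2 = 1"
    using d_ge_1 by (simp add: euclid_norm_power2)
  ultimately show ?thesis by simp
qed

lemma F_eq: "x \<in> carrier_vec d \<Longrightarrow> F x = 1 / 2 * scalar_prod x (mean_mat d n A *\<^sub>v x)"
  by (simp only: F_def mean_quadratic)

lemma F_ge: "x \<in> carrier_vec d \<Longrightarrow> F x \<ge> \<mu> / 2 * (euclid_norm x)\<^sup>2"
  using mean_form_ge[of x] by (simp add: F_eq)

lemma F_le: "x \<in> carrier_vec d \<Longrightarrow> F x \<le> L / 2 * (euclid_norm x)\<^sup>2"
  using mean_form_le[of x] by (simp add: F_eq)

lemma F_zero: "F (0\<^sub>v d) = 0"
  using mean_mat_carrier by (simp add: F_eq)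

lemma F_nonneg: "x \<in> carrier_vec d \<Longrightarrow> F x \<ge> 0"
  using F_ge[of x] \<mu>_pos by (meson divide_nonneg_nonneg less_imp_le mult_nonneg_nonneg order_trans zero_le_numeral zero_le_power2)

lemma INF_F: "(INF x \<in> carrier_vec d. F x) = 0"
proof (rule cInf_eq_minimum)
  show "0 \<in> F ` carrier_vec d"
    using F_zero by (metis imageI zero_carrier_vec)
qed (auto intro: F_nonneg)

lemma is_arg_min_F: "is_arg_min F (\<lambda>x. x \<in> carrier_vec d) x \<longleftrightarrow> x = 0\<^sub>v d"
proof
  assume min: "is_arg_min F (\<lambda>x. x \<in> carrier_vec d) x"
  then have x: "x \<in> carrier_vec d" and "F x \<le> F (0\<^sub>v d)"
    unfolding is_arg_min_linorder by auto
  then have "\<mu> / 2 * (euclid_norm x)\<^sup>2 \<le> 0"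
    using F_ge[OF x] F_zero by simp
  then have "euclid_norm x = 0"
    using \<mu>_pos by (simp add: mult_le_0_iff)
  then show "x = 0\<^sub>v d" by (rule euclid_norm_eq_0[OF x])
next
  assume "x = 0\<^sub>v d"
  then show "is_arg_min F (\<lambda>x. x \<in> carrier_vec d) x"
    by (simp add: is_arg_min_linorder F_zero F_nonneg)
qed

lemma epoch_iter_carrier:
  assumes "\<pi> \<in> perms n" "y \<in> carrier_vec d"
  shows "i \<le> n \<Longrightarrow> epoch_iter f \<eta> \<pi> y i \<in> carrier_vec d"
proof (induction i)
  case (Suc i)
  have "\<pi> (Suc i) \<in> {1..n}" using Suc.prems assms perms_in by simp
  then show ?case
    using Suc by (simp add: gradient_quadratic[OF A_carrier A_symmetric b_carrier] b_carrier)
qed (use assms in simp)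

lemma emb_epoch_iter:
  assumes "\<pi> \<in> perms n" "y \<in> carrier_vec d" "\<eta> \<ge> 0" "\<eta> * real n * L < 1"
  shows "i \<le> n \<Longrightarrow> emb (epoch_iter f (\<lambda>_. \<eta>) \<pi> y i) = shuffled_quadratics.iter mat_op emb_b \<eta> \<pi> (emb y) i"
proof (induction i)
  interpret shuffled_quadratics n mat_op emb_b L G \<eta>
    using assms by (intro shuffled_quadratics)
  case 0
  show ?case by simp
next
  interpret shuffled_quadratics n mat_op emb_b L G \<eta>
    using assms by (intro shuffled_quadratics)
  case (Suc i)
  let ?z = "epoch_iter f (\<lambda>_. \<eta>) \<pi> y i" and ?a = "\<pi> (Suc i)"
  have a: "?a \<in> {1..n}" using Suc.prems assms perms_in by simp
  have z: "?z \<in> carrier_vec d" using Suc.prems assms by (intro epoch_iter_carrier) auto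
  have "emb (epoch_iter f (\<lambda>_. \<eta>) \<pi> y (Suc i)) = emb ?z - \<eta> *\<^sub>R emb (A ?a *\<^sub>v ?z + b ?a)"
    using a z by (simp add: gradient_quadratic[OF A_carrier A_symmetric b_carrier] b_carrier
        emb_diff[of _ d] emb_smult)
  also have "\<dots> = emb ?z - \<eta> *\<^sub>R (mat_op ?a (emb ?z) + emb_b ?a)"
    using a z by (simp add: emb_add[of _ d] b_carrier mat_op_def emb_b_def)
  finally show ?case using Suc by simp
qed

lemma random_shuffle_carrier:
  assumes "x \<in> carrier_vec d" "\<And>j. j \<in> {1..k} \<Longrightarrow> \<sigma> j \<in> perms n"
  shows "random_shuffle n f \<eta> \<sigma> x k \<in> carrier_vec d"
  using assms(2)
proof (induction k)
  case (Suc k)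
  then show ?case by (auto intro!: epoch_iter_carrier)
qed (use assms in simp)

section \<open>Iteration of the contraction over the epochs\<close>

context
  fixes \<eta> :: real
  assumes \<eta>_pos: "\<eta> > 0" and \<epsilon>_le: "\<eta> * real n * L \<le> 3 / 16"
    and cond: "(\<eta> * real n * L)\<^sup>2 * L \<le> 9 / 256 * real n * \<mu>"
begin

abbreviation \<theta> :: real where "\<theta> \<equiv> \<eta> * real n * \<mu>"

definition noise :: real where
  "noise = 11 * (\<eta> * real n * L * \<eta> * G)\<^sup>2 / \<theta> + 52 * (\<eta> * real n * L)\<^sup>2 * \<eta>\<^sup>2 * real n * G\<^sup>2"

lemma \<theta>_pos: "\<theta> > 0" and \<theta>_le_1: "\<theta> \<le> 1"
proof -
  show "\<theta> > 0" using \<eta>_pos \<mu>_pos n_ge_2 by simp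
  have "\<theta> \<le> \<eta> * real n * L"
    using \<mu>_le_L \<eta>_pos by (intro mult_left_mono) auto
  then show "\<theta> \<le> 1" using \<epsilon>_le by simp
qed

lemma avg_epoch_le:
  assumes y: "y \<in> carrier_vec d"
  shows "avg (perms n) (\<lambda>\<pi>. (euclid_norm (epoch_iter f (\<lambda>_. \<eta>) \<pi> y n))\<^sup>2)
    \<le> (1 - \<theta>) * (euclid_norm y)\<^sup>2 + noise"
proof -
  have small: "\<eta> * real n * L < 1" using \<epsilon>_le by simp
  interpret shuffled_quadratics n mat_op emb_b L G \<eta>
    using \<eta>_pos small by (intro shuffled_quadratics) auto
  have "avg (perms n) (\<lambda>\<pi>. (euclid_norm (epoch_iter f (\<lambda>_. \<eta>) \<pi> y n))\<^sup>2)
      = avg (perms n) (\<lambda>\<pi>. (norm (iter \<pi> (emb y) n))\<^sup>2)"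
    using y \<eta>_pos small by (intro avg_cong) (simp add: emb_epoch_iter[symmetric] norm_emb)
  also have "\<dots> \<le> (1 - \<theta>) * (norm (emb y))\<^sup>2
    + 11 * (\<epsilon> * \<eta> * G)\<^sup>2 / \<theta> + 52 * \<epsilon>\<^sup>2 * \<eta>\<^sup>2 * real n * G\<^sup>2"
  proof (rule epoch_contraction[OF \<mu>_pos \<eta>_pos _ _ \<epsilon>_le cond])
    show "0 \<le> inner x (mean_op x)" for x
      unfolding inner_mean_op using F_nonneg[of "proj d x"] by (simp add: F_eq)
    show "\<mu> * (norm (emb y))\<^sup>2 \<le> inner (emb y) (mean_op (emb y))"
      unfolding inner_mean_op using mean_form_ge[OF y] y by (simp add: norm_emb)
  qed
  finally show ?thesis by (simp add: noise_def norm_emb)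
qed

text \<open>The number \<open>noise / \<theta>\<close> is the fixed point of the map that sends
  \<open>N\<close> to \<open>(1 - \<theta>) * N + noise\<close>, so the bound reproduces itself from
  epoch to epoch.\<close>

lemma expectation_norm_le:
  assumes x: "x \<in> carrier_vec d"
  shows "measure_pmf.expectation (shuffle_pmf n k)
      (\<lambda>\<sigma>. (euclid_norm (random_shuffle n f (\<lambda>_ _. \<eta>) \<sigma> x k))\<^sup>2)
    \<le> (1 - \<theta>) ^ k * (euclid_norm x)\<^sup>2 + noise / \<theta>"
proof (induction k)
  case 0
  have "noise \<ge> 0" using \<theta>_pos by (simp add: noise_def)
  then show ?case using \<theta>_pos by simp
next
  case (Suc k)
  let ?x = "\<lambda>\<sigma>. random_shuffle n f (\<lambda>_ _. \<eta>) \<sigma> x k"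
  let ?E = "measure_pmf.expectation (shuffle_pmf n k)"
  have "measure_pmf.expectation (shuffle_pmf n (Suc k))
      (\<lambda>\<sigma>. (euclid_norm (random_shuffle n f (\<lambda>_ _. \<eta>) \<sigma> x (Suc k)))\<^sup>2)
    = ?E (\<lambda>\<sigma>. avg (perms n) (\<lambda>\<pi>. (euclid_norm (epoch_iter f (\<lambda>_. \<eta>) \<pi> (?x \<sigma>) n))\<^sup>2))"
    by (simp add: expectation_shuffle_pmf_Suc random_shuffle_upd)
  also have "\<dots> \<le> ?E (\<lambda>\<sigma>. (1 - \<theta>) * (euclid_norm (?x \<sigma>))\<^sup>2 + noise)"
    using x by (intro expectation_shuffle_pmf_mono avg_epoch_le random_shuffle_carrier set_shuffle_pmf) auto
  also have "\<dots> = (1 - \<theta>) * ?E (\<lambda>\<sigma>. (euclid_norm (?x \<sigma>))\<^sup>2) + noise"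
    by (subst Bochner_Integration.integral_add)
       (simp_all add: integrable_measure_pmf_finite finite_set_shuffle_pmf)
  also have "\<dots> \<le> (1 - \<theta>) * ((1 - \<theta>) ^ k * (euclid_norm x)\<^sup>2 + noise / \<theta>) + noise"
    using \<theta>_le_1 Suc.IH by (intro add_right_mono mult_left_mono) auto
  also have "\<dots> = (1 - \<theta>) ^ Suc k * (euclid_norm x)\<^sup>2 + noise / \<theta>"
  proof -
    have "(1 - t) * (p + N / t) + N = (1 - t) * p + N / t" if "t > 0" for t p N :: real
      using that by (simp add: field_simps)
    from this[OF \<theta>_pos] show ?thesis by simp
  qed
  finally show ?case .
qed

lemma expectation_F_le:
  assumes x: "x \<in> carrier_vec d"
  shows "measure_pmf.expectation (shuffle_pmf n k) (\<lambda>\<sigma>. F (random_shuffle n f (\<lambda>_ _. \<eta>) \<sigma> x k))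
    \<le> L / 2 * ((1 - \<theta>) ^ k * (euclid_norm x)\<^sup>2 + noise / \<theta>)"
proof -
  have "measure_pmf.expectation (shuffle_pmf n k) (\<lambda>\<sigma>. F (random_shuffle n f (\<lambda>_ _. \<eta>) \<sigma> x k))
    \<le> measure_pmf.expectation (shuffle_pmf n k)
        (\<lambda>\<sigma>. L / 2 * (euclid_norm (random_shuffle n f (\<lambda>_ _. \<eta>) \<sigma> x k))\<^sup>2)"
    using x by (intro expectation_shuffle_pmf_mono F_le random_shuffle_carrier set_shuffle_pmf) auto
  also have "\<dots> = L / 2 * measure_pmf.expectation (shuffle_pmf n k)
        (\<lambda>\<sigma>. (euclid_norm (random_shuffle n f (\<lambda>_ _. \<eta>) \<sigma> x k))\<^sup>2)"
    by (rule integral_mult_right_zero)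
  also have "\<dots> \<le> L / 2 * ((1 - \<theta>) ^ k * (euclid_norm x)\<^sup>2 + noise / \<theta>)"
    using L_pos by (intro mult_left_mono expectation_norm_le x) auto
  finally show ?thesis .
qed

end

text \<open>With this step size \<open>(1 - \<eta> n \<mu>) ^ K\<close> is at most \<open>exp (- 2 ln (n K)) = 1 / (n K)\<^sup>2\<close>.\<close>

lemma random_shuffle_rate:
  fixes K :: nat
  defines "\<kappa> \<equiv> L / \<mu>" and "l \<equiv> ln (real n * real K)"
  defines "\<eta> \<equiv> 2 * l / (\<mu> * real n * real K)"
  assumes x: "x \<in> carrier_vec d" and K: "K \<ge> 1"
    and K_large: "real K \<ge> 32 / 3 * \<kappa> * max 1 (sqrt (\<kappa> / real n)) * l"
  shows "measure_pmf.expectation (shuffle_pmf n K) (\<lambda>\<sigma>. F (random_shuffle n f (\<lambda>_ _. \<eta>) \<sigma> x K))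
    \<le> 2 * L * (euclid_norm x)\<^sup>2 / ((real n)\<^sup>2 * (real K)\<^sup>2)
      + (22 * G\<^sup>2 / L * \<kappa> ^ 4) * l\<^sup>2 / ((real n)\<^sup>2 * (real K)\<^sup>2)
      + (416 * G\<^sup>2 / L * \<kappa> ^ 4) * l ^ 4 / (real n * real K ^ 3)"
proof -
  define m where "m = max 1 (sqrt (\<kappa> / real n))"
  define \<epsilon> where "\<epsilon> = \<eta> * real n * L"
  define \<theta> where "\<theta> = \<eta> * real n * \<mu>"
  have n: "real n \<ge> 2" and K1: "real K \<ge> 1" using n_ge_2 K by auto
  have nK: "real n * real K \<ge> 2" using mult_mono[OF n K1] by simp
  \<comment> \<open>This bound makes the step size positive and later pays for one more factor
    \<open>l\<close>.\<close>
  have "1 / 2 \<le> ln (2::real)" using ln2_ge_two_thirds by simp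
  also have "\<dots> \<le> l" unfolding l_def using nK by (subst ln_le_cancel_iff) auto
  finally have l: "1 / 2 \<le> l" .
  have \<eta>: "\<eta> > 0" using l \<mu>_pos n K1 by (simp add: \<eta>_def)
  have \<kappa>: "\<kappa> > 0" using L_pos \<mu>_pos by (simp add: \<kappa>_def)
  have m: "m \<ge> 1" "m \<ge> sqrt (\<kappa> / real n)" by (simp_all add: m_def)
  have \<epsilon>_eq: "\<epsilon> = 2 * \<kappa> * l / real K"
    using n \<mu>_pos by (simp add: \<epsilon>_def \<eta>_def \<kappa>_def field_simps)
  have \<epsilon>0: "\<epsilon> > 0" using \<eta> n L_pos by (simp add: \<epsilon>_def)
  \<comment> \<open>Origin of \<open>3 / 16\<close>: the bound \<open>32 / 3\<close> on
    \<open>K\<close> gives \<open>2 * 3 / 32\<close>.\<close>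
  have \<epsilon>m: "\<epsilon> * m \<le> 3 / 16"
    using K_large K1 unfolding \<epsilon>_eq m_def[symmetric] by (simp add: field_simps)
  have \<epsilon>_le: "\<epsilon> \<le> 3 / 16"
    using mult_left_mono[OF m(1), of \<epsilon>] \<epsilon>0 \<epsilon>m by linarith
  \<comment> \<open>Squaring this use of the second part of the maximum produces
    \<open>cond\<close>.\<close>
  have "\<epsilon> * sqrt (\<kappa> / real n) \<le> 3 / 16"
    using mult_left_mono[OF m(2), of \<epsilon>] \<epsilon>0 \<epsilon>m by linarith
  then have "(\<epsilon> * sqrt (\<kappa> / real n))\<^sup>2 \<le> (3 / 16)\<^sup>2"
    using \<epsilon>0 \<kappa> by (intro power_mono) auto
  then have "\<epsilon>\<^sup>2 * (\<kappa> / real n) \<le> 9 / 256"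
    using \<kappa> by (simp add: power_mult_distrib power_divide)
  then have cond: "\<epsilon>\<^sup>2 * L \<le> 9 / 256 * real n * \<mu>"
    using n \<mu>_pos by (simp add: \<kappa>_def field_simps)
  note params = \<eta> \<epsilon>_le[unfolded \<epsilon>_def] cond[unfolded \<epsilon>_def]
  have \<theta>: "\<theta> > 0" "\<theta> \<le> 1"
    unfolding \<theta>_def by (rule \<theta>_pos[OF params] \<theta>_le_1[OF params])+
  have contraction: "(1 - \<theta>) ^ K \<le> 1 / ((real n)\<^sup>2 * (real K)\<^sup>2)"
  proof -
    have "(1 - \<theta>) ^ K \<le> exp (- \<theta>) ^ K"
      using exp_ge_add_one_self[of "- \<theta>"] \<theta> by (intro power_mono) auto
    also have "\<dots> = exp (- (real K * \<theta>))"
      by (simp add: exp_of_nat_mult[symmetric])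
    also have "real K * \<theta> = 2 * l"
      using n K1 \<mu>_pos by (simp add: \<theta>_def \<eta>_def field_simps)
    also have "exp (- (2 * l)) = 1 / (exp l)\<^sup>2"
      by (simp add: exp_minus inverse_eq_divide exp_double)
    also have "exp l = real n * real K"
      unfolding l_def using nK by (intro exp_ln) auto
    finally show ?thesis by (simp add: power_mult_distrib)
  qed
  have noise: "noise \<eta> / \<theta> = 11 * (L * \<eta> * G / \<mu>)\<^sup>2 + 52 * L\<^sup>2 * \<eta> ^ 3 * (real n)\<^sup>2 * G\<^sup>2 / \<mu>"
    using \<eta> n \<mu>_pos unfolding noise_def[OF params] \<theta>_def
    by (simp add: field_simps power2_eq_square power3_eq_cube)
  have first: "L / 2 * (11 * (L * \<eta> * G / \<mu>)\<^sup>2)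
      = (22 * G\<^sup>2 / L * \<kappa> ^ 4) * l\<^sup>2 / ((real n)\<^sup>2 * (real K)\<^sup>2)"
    using n K1 \<mu>_pos L_pos
    by (simp add: \<eta>_def \<kappa>_def field_simps power2_eq_square power4_eq_xxxx)
  have "L / 2 * (52 * L\<^sup>2 * \<eta> ^ 3 * (real n)\<^sup>2 * G\<^sup>2 / \<mu>)
      = (208 * G\<^sup>2 / L * \<kappa> ^ 4) * l ^ 3 / (real n * real K ^ 3)"
    using n K1 \<mu>_pos L_pos
    by (simp add: \<eta>_def \<kappa>_def field_simps power2_eq_square power3_eq_cube power4_eq_xxxx)
  also have "\<dots> \<le> (208 * G\<^sup>2 / L * \<kappa> ^ 4) * (2 * l ^ 4) / (real n * real K ^ 3)"
  proof (intro divide_right_mono mult_left_mono)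
    \<comment> \<open>The cube comes from \<open>\<eta> ^ 3\<close>. Passing to the fourth power by
      \<open>1 \<le> 2 * l\<close> doubles 208 to 416.\<close>
    show "l ^ 3 \<le> 2 * l ^ 4"
      using mult_right_mono[of 1 "2 * l" "l ^ 3"] l by (simp add: power3_eq_cube power4_eq_xxxx mult.assoc)
  qed (use L_pos \<kappa> in auto)
  finally have second: "L / 2 * (52 * L\<^sup>2 * \<eta> ^ 3 * (real n)\<^sup>2 * G\<^sup>2 / \<mu>)
      \<le> (416 * G\<^sup>2 / L * \<kappa> ^ 4) * l ^ 4 / (real n * real K ^ 3)"
    by (simp add: algebra_simps)
  \<comment> \<open>The contraction alone gives the factor \<open>L / 2\<close>, which is relaxed to
    \<open>2 * L\<close>.\<close>
  have start: "L / 2 * ((1 - \<theta>) ^ K * (euclid_norm x)\<^sup>2)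
      \<le> 2 * L * (euclid_norm x)\<^sup>2 / ((real n)\<^sup>2 * (real K)\<^sup>2)"
  proof -
    have "L / 2 * ((1 - \<theta>) ^ K * (euclid_norm x)\<^sup>2)
        \<le> 2 * L * (1 / ((real n)\<^sup>2 * (real K)\<^sup>2) * (euclid_norm x)\<^sup>2)"
      using L_pos \<theta> by (intro mult_mono mult_right_mono contraction) auto
    then show ?thesis by simp
  qed
  have "measure_pmf.expectation (shuffle_pmf n K) (\<lambda>\<sigma>. F (random_shuffle n f (\<lambda>_ _. \<eta>) \<sigma> x K))
      \<le> L / 2 * ((1 - \<theta>) ^ K * (euclid_norm x)\<^sup>2 + noise \<eta> / \<theta>)"
    unfolding \<theta>_def by (rule expectation_F_le[OF params x])
  also have "\<dots> = L / 2 * ((1 - \<theta>) ^ K * (euclid_norm x)\<^sup>2) + L / 2 * (11 * (L * \<eta> * G / \<mu>)\<^sup>2)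
      + L / 2 * (52 * L\<^sup>2 * \<eta> ^ 3 * (real n)\<^sup>2 * G\<^sup>2 / \<mu>)"
    unfolding noise distrib_left by simp
  finally show ?thesis
    using start first second by linarith
qed

end

theorem theorem2:
  fixes L G :: real
  assumes L_pos: "L > 0"
  shows "\<exists>C :: real.
    \<forall>(n :: nat) (d :: nat) (K :: nat) (\<mu> :: real) (A :: nat \<Rightarrow> real Matrix.mat)
     (b :: nat \<Rightarrow> real Matrix.vec) (x\<^sub>0 :: real Matrix.vec).
      let \<kappa> = L / \<mu>;
          f = (\<lambda>i. quadratic (A i) (b i));
          F = mean_fun n f;
          A\<^sub>m = mean_mat d n A;
          \<eta> = 2 * ln (real n * real K) / (\<mu> * real n * real K);
          x\<^sub>s = 0\<^sub>v d;
          F\<^sub>s = (INF x \<in> carrier_vec d. F x)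
      in
        n \<ge> 2 \<and> d \<ge> 1 \<and> K \<ge> 1 \<and> \<mu> > 0 \<and>
        (\<forall>i \<in> {1..n}. A i \<in> carrier_mat d d \<and> symmetric_mat (A i) \<and> b i \<in> carrier_vec d) \<and>
        (\<forall>i \<in> {1..n}. spectral_norm (A i) \<le> L) \<and>
        G = Max ((\<lambda>i. euclid_norm (b i)) ` {1..n}) \<and>
        (\<forall>x \<in> carrier_vec d. F x = 1 / 2 * scalar_prod x (A\<^sub>m *\<^sub>v x)) \<and>
        pos_semidef (A\<^sub>m - \<mu> \<cdot>\<^sub>m 1\<^sub>m d) \<and>
        x\<^sub>0 \<in> carrier_vec d \<and>
        real K \<ge> 32 / 3 * \<kappa> * max 1 (sqrt (\<kappa> / real n)) * ln (real n * real K)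
        \<longrightarrow>
        (\<forall>x. is_arg_min F (\<lambda>x. x \<in> carrier_vec d) x \<longleftrightarrow> x = x\<^sub>s) \<and>
        (\<exists>c\<^sub>1 c\<^sub>2 :: real. \<bar>c\<^sub>1\<bar> \<le> C * \<kappa> ^ 4 \<and> \<bar>c\<^sub>2\<bar> \<le> C * \<kappa> ^ 4 \<and>
          measure_pmf.expectation (shuffle_pmf n K)
            (\<lambda>\<sigma>. F (random_shuffle n f (\<lambda>k i. \<eta>) \<sigma> x\<^sub>0 K)) - F\<^sub>s
          \<le> 2 * L * (euclid_norm (x\<^sub>0 - x\<^sub>s))\<^sup>2 / ((real n)\<^sup>2 * (real K)\<^sup>2)
            + c\<^sub>1 * (ln (real n * real K))\<^sup>2 / ((real n)\<^sup>2 * (real K)\<^sup>2)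
            + c\<^sub>2 * (ln (real n * real K)) ^ 4 / (real n * (real K) ^ 3))"
proof (rule exI[of _ "416 * G\<^sup>2 / L"], intro allI, unfold Let_def, intro impI, goal_cases)
  case (1 n d K \<mu> A b x\<^sub>0)
  interpret quadratic_problem n d A b L G \<mu>
  proof
    show "euclid_norm (b i) \<le> G" if "i \<in> {1..n}" for i
    proof -
      have "G = Max ((\<lambda>i. euclid_norm (b i)) ` {1..n})" using 1 by blast
      then show ?thesis using that by simp
    qed
  qed (use 1 L_pos in blast)+
  let ?\<kappa> = "L / \<mu>"
  have \<kappa>: "?\<kappa> ^ 4 \<ge> 0" by simp
  have x: "x\<^sub>0 \<in> carrier_vec d" and K: "K \<ge> 1"
    and K_large: "real K \<ge> 32 / 3 * ?\<kappa> * max 1 (sqrt (?\<kappa> / real n)) * ln (real n * real K)"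
    using 1 by blast+
  have "x\<^sub>0 - 0\<^sub>v d = x\<^sub>0" using x by auto
  \<comment> \<open>The witnesses are the coefficients of the rate. Both are at most
    \<open>416 * G\<^sup>2 / L\<close> times the fourth power of \<open>L / \<mu>\<close>, and this
    constant depends only on \<open>L\<close> and \<open>G\<close>.\<close>
  with random_shuffle_rate[OF x K K_large]
  show ?case
    unfolding F_def[symmetric] INF_F
    using L_pos \<kappa>
    by (intro conjI allI is_arg_min_F exI[of _ "22 * G\<^sup>2 / L * ?\<kappa> ^ 4"] exI[of _ "416 * G\<^sup>2 / L * ?\<kappa> ^ 4"])
       (simp_all add: divide_right_mono mult_right_mono)
qed

end
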